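(* Let $G$ be a fractionally-critical triangle-free finite simple graph with maximum degree at most $3$ and $\frac{11}{4}<\chi_f(G)<3$. If $V(G)$ can be partitioned into $k$ admissible sets, then $\chi_f(G)\le 3-\frac{3}{k+1}$.
   Context: $\chi_f$ denotes the fractional chromatic number. $G$ is fractionally-critical if $\chi_f(H)<\chi_f(G)$ for every proper subgraph $H$ of $G$. For a vertex $u$ and positive integer $i$, $N_G^i(u)=\{v\in V(G): v\ne u \text{ and there is a path of length } i \text{ in } G \text{ connecting } u \text{ and } v\}$. A set $X\subseteq V(G)$ is admissible if it can be partitioned into three sets $X_1,X_2,X_3$ such that: (1) if $\{u,v\}\subseteq X_i$ for some $i$, then $v\notin N_G^1(u)\cup N_G^3(u)\cup N_G^5(u)$; (2) if $u\in X_i$ and $v\in X_j$ with $i\ne j$, then $v\notin N_G^1(u)\cup N_G^2(u)\cup N_G^4(u)$. *)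

theory Defs
  imports
    Complex_Main
    "HOL-Library.Disjoint_Sets"
    "Graph_Theory.Pair_Digraph"
    "Graph_Theory.Digraph_Component"
    "Graph_Theory.Vertex_Walk"
begin

text \<open>
  A finite simple graph is an element of the locale \<open>pair_graph\<close>: a finite, loop-free digraph
  whose arc relation is symmetric, an undirected edge being the pair of arcs \<open>(u, v)\<close>, \<open>(v, u)\<close>.
  Hence \<open>out_degree\<close> is the usual vertex degree.
\<close>

text \<open>
  An \<open>(a:b)\<close>-colouring assigns to every vertex \<open>b\<close> of the \<open>a\<close> colours \<open>0, \<dots>, a - 1\<close>, with
  disjoint colour sets at adjacent vertices.
\<close>

definition fold_coloring ::
    "'a pair_pre_digraph \<Rightarrow> nat \<Rightarrow> nat \<Rightarrow> ('a \<Rightarrow> nat set) \<Rightarrow> bool" where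
  "fold_coloring G a b c \<longleftrightarrow>
     (\<forall>v \<in> pverts G. c v \<subseteq> {..<a} \<and> card (c v) = b) \<and>
     (\<forall>u \<in> pverts G. \<forall>v \<in> pverts G. u \<rightarrow>\<^bsub>G\<^esub> v \<longrightarrow> c u \<inter> c v = {})"

definition fractional_chromatic_number :: "'a pair_pre_digraph \<Rightarrow> real" where
  "fractional_chromatic_number G =
     Inf {real a / real b | a b. a > 0 \<and> b > 0 \<and> (\<exists>c. fold_coloring G a b c)}"

text \<open>
  The requirement \<open>pair_graph H\<close> is not redundant: \<open>subgraph\<close> is the digraph notion, which also
  admits deleting only one of the two arcs of an edge.
\<close>

definition fractionally_critical :: "'a pair_pre_digraph \<Rightarrow> bool" where
  "fractionally_critical G \<longleftrightarrow>
     (\<forall>H :: 'a pair_pre_digraph. pair_graph H \<and> subgraph H G \<and> H \<noteq> G \<longrightarrow>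
        fractional_chromatic_number H < fractional_chromatic_number G)"

definition triangle_free :: "'a pair_pre_digraph \<Rightarrow> bool" where
  "triangle_free G \<longleftrightarrow> \<not> (\<exists>u v w. u \<rightarrow>\<^bsub>G\<^esub> v \<and> v \<rightarrow>\<^bsub>G\<^esub> w \<and> w \<rightarrow>\<^bsub>G\<^esub> u)"

text \<open>
  The vertices joined to \<open>u\<close> by some path (without repeated vertices) of length exactly \<open>i\<close>; their
  distance from \<open>u\<close> may be smaller than \<open>i\<close>.
\<close>

definition path_nbrs :: "'a pair_pre_digraph \<Rightarrow> nat \<Rightarrow> 'a \<Rightarrow> 'a set" where
  "path_nbrs G i u =
     {v \<in> pverts G. v \<noteq> u \<and> (\<exists>p. vpath p G \<and> hd p = u \<and> last p = v \<and> vwalk_length p = i)}"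

text \<open>Unlike in \<open>partition_on\<close>, the parts are indexed and may be empty.\<close>

definition partition_into :: "'a set \<Rightarrow> nat \<Rightarrow> (nat \<Rightarrow> 'a set) \<Rightarrow> bool" where
  "partition_into A k P \<longleftrightarrow> disjoint_family_on P {..<k} \<and> (\<Union>i<k. P i) = A"

definition admissible :: "'a pair_pre_digraph \<Rightarrow> 'a set \<Rightarrow> bool" where
  "admissible G X \<longleftrightarrow> X \<subseteq> pverts G \<and>
     (\<exists>P. partition_into X 3 P \<and>
        (\<forall>i<3. \<forall>u \<in> P i. \<forall>v \<in> P i.
           v \<notin> path_nbrs G 1 u \<union> path_nbrs G 3 u \<union> path_nbrs G 5 u) \<and>
        (\<forall>i<3. \<forall>j<3. i \<noteq> j \<longrightarrow> (\<forall>u \<in> P i. \<forall>v \<in> P j.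
           v \<notin> path_nbrs G 1 u \<union> path_nbrs G 2 u \<union> path_nbrs G 4 u)))"

end

theory Submission
  imports Defs
begin

text \<open>
  For each admissible set \<open>X\<close> with classes \<open>X\<^sub>0, X\<^sub>1, X\<^sub>2\<close> we find a 3-colouring of \<open>G - X\<close> giving
  colour \<open>i\<close> to every neighbour of \<open>X\<^sub>i\<close>, so that a vertex of \<open>X\<close> may use both colours other than
  its own index. Putting the \<open>k\<close> colourings side by side on disjoint palettes is a \<open>(3k : k + 1)\<close>-colouring.

  Colouring the rest \<open>R\<close> of \<open>G\<close> is a list colouring problem in which no list is shorter than the degree
  in \<open>R\<close>. A minimal uncolourable subset has, at some end block, an odd cycle whose vertices other
  than one vertex \<open>w\<close> all miss the same colour; the condition on paths of length 5 forces them all to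
  be at distance two from a single \<open>u \<in> X\<close>. By the degree bound the cycle has length 5 or 7. In the
  second case the edge leaving \<open>w\<close> is a bridge, contradicting criticality. In the first case delete
  \<open>u\<close>, the cycle and the vertices joining them: a colouring of the remaining graph in ratio below
  \<open>\<chi>\<^sub>f(G)\<close> extends as soon as the ratio is at least 11/4, contradicting criticality again.
\<close>

section \<open>List colourings and minimal uncolourable sets\<close>

text \<open>The lengths 1 to 4 in the definition of admissibility each pay for one part of the
  precolouring: length 1 makes \<open>X\<close> independent, length 2 keeps the neighbourhoods of
  different classes disjoint, length 3 together with triangle-freeness makes the neighbourhood of a
  single class independent, and length 4 lets a remaining vertex lose at most one colour. The lists
  may then be exactly as long as the degrees, and tight lists can fail: by the theory of
  degree-choosability this happens only on components all of whose blocks are complete graphs or odd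
  cycles. Examining one end block is enough. On it the lists are constant, so either all are full,
  which a Brooks argument excludes, or all miss one colour, which leaves degree two and hence an odd
  cycle. The ratio 11/4 means that each vertex takes four of eleven equal blocks of colours: two
  outside neighbours then spoil at most eight blocks' worth of colours, and three blocks remain that
  satisfy both constraints.\<close>

definition list_coloring :: "('a \<Rightarrow> 'a \<Rightarrow> bool) \<Rightarrow> ('a \<Rightarrow> nat set) \<Rightarrow> 'a set \<Rightarrow> ('a \<Rightarrow> nat) \<Rightarrow> bool" where
  "list_coloring adj L S f \<longleftrightarrow>
     (\<forall>v\<in>S. f v \<in> L v) \<and> (\<forall>u\<in>S. \<forall>v\<in>S. adj u v \<longrightarrow> f u \<noteq> f v)"

text \<open>A union of connected components of the graph induced on \<open>S\<close>, possibly
  empty.\<close>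

definition closed_in :: "('a \<Rightarrow> 'a \<Rightarrow> bool) \<Rightarrow> 'a set \<Rightarrow> 'a set \<Rightarrow> bool" where
  "closed_in adj S Q \<longleftrightarrow> Q \<subseteq> S \<and> (\<forall>x\<in>Q. \<forall>y\<in>S. adj x y \<longrightarrow> y \<in> Q)"

definition nbrs_in :: "('a \<Rightarrow> 'a \<Rightarrow> bool) \<Rightarrow> 'a set \<Rightarrow> 'a \<Rightarrow> 'a set" where
  "nbrs_in adj S v = {y \<in> S. adj v y}"

lemma closed_in_path:
  fixes v :: "nat \<Rightarrow> 'a"
  assumes adj: "symp adj" and Q: "closed_in adj S Q"
    and S: "\<And>i. l \<le> i \<Longrightarrow> i \<le> m \<Longrightarrow> v i \<in> S"
    and step: "\<And>i. l \<le> i \<Longrightarrow> i < m \<Longrightarrow> adj (v i) (v (Suc i))"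
    and k: "l \<le> k" "k \<le> m" "v k \<in> Q" and i: "l \<le> i" "i \<le> m"
  shows "v i \<in> Q"
proof -
  have up: "v (k + d) \<in> Q" if "k + d \<le> m" for d
    using that
  proof (induction d)
    case (Suc d)
    then show ?case
      using Q step[of "k + d"] S[of "Suc (k + d)"] k by (auto simp: closed_in_def)
  qed (use k in simp)
  have down: "v (k - d) \<in> Q" if "l \<le> k - d" for d
    using that
  proof (induction d)
    case (Suc d)
    show ?case
    proof (cases "d < k")
      case True
      then have e: "Suc (k - Suc d) = k - d" by simp
      then have "adj (v (k - d)) (v (k - Suc d))"
        using step[of "k - Suc d"] Suc.prems k True adj by (metis Suc_le_lessD le_trans diff_le_self sympD)
      moreover have "v (k - Suc d) \<in> S"
        using S[of "k - Suc d"] Suc.prems k by simp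
      moreover have "v (k - d) \<in> Q" using Suc by simp
      ultimately show ?thesis using Q by (auto simp: closed_in_def)
    qed (use Suc in simp)
  qed (use k in simp)
  show ?thesis
  proof (cases "k \<le> i")
    case True
    then show ?thesis using up[of "i - k"] i by simp
  next
    case False
    then show ?thesis using down[of "k - i"] i by simp
  qed
qed

text \<open>If \<open>Q\<close> is an inclusion-minimal uncolourable set, then
  \<open>Q - {v}\<close> can be coloured, so the colours at the neighbours of \<open>v\<close> must
  exhaust its list. The list size is thus at most the degree in \<open>Q\<close>, which is at most
  the degree in \<open>S\<close>, which is at most the list size. Equality throughout leaves
  \<open>v\<close> no neighbour in \<open>S\<close> outside \<open>Q\<close>.\<close>

lemma list_coloring_minimal_obstruction:
  assumes fin: "finite S" and irr: "irreflp adj" and sym: "symp adj"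
    and L: "\<And>v. v \<in> S \<Longrightarrow> finite (L v)" "\<And>v. v \<in> S \<Longrightarrow> card (nbrs_in adj S v) \<le> card (L v)"
    and no: "\<nexists>f. list_coloring adj L S f"
  obtains Q where "Q \<noteq> {}" "closed_in adj S Q" "\<nexists>f. list_coloring adj L Q f"
    "\<And>T. T \<subset> Q \<Longrightarrow> \<exists>f. list_coloring adj L T f"
    "\<And>v. v \<in> Q \<Longrightarrow> card (L v) = card (nbrs_in adj Q v)"
proof -
  obtain Q where Q: "Q \<subseteq> S" "\<nexists>f. list_coloring adj L Q f"
    and min: "\<And>T. T \<subset> Q \<Longrightarrow> \<exists>f. list_coloring adj L T f"
  proof -
    define B where "B = {Q. Q \<subseteq> S \<and> (\<nexists>f. list_coloring adj L Q f)}"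
    have "finite B" "B \<noteq> {}" using fin no unfolding B_def by auto
    then obtain Q where Q: "Q \<in> B" "\<And>T. T \<in> B \<Longrightarrow> T \<subseteq> Q \<Longrightarrow> Q = T"
      using finite_has_minimal[of B] by metis
    have "\<exists>f. list_coloring adj L T f" if "T \<subset> Q" for T
    proof (rule ccontr)
      assume "\<not> ?thesis"
      then have "T \<in> B" using that Q(1) by (auto simp: B_def)
      then show False using Q(2) that by blast
    qed
    then show ?thesis using that[of Q] Q(1) by (simp add: B_def)
  qed
  have finQ: "finite Q" using Q fin finite_subset by blast
  have tight: "card (L v) \<le> card (nbrs_in adj Q v)" if v: "v \<in> Q" for v
  proof (rule ccontr)
    assume less: "\<not> ?thesis"
    obtain f where f: "list_coloring adj L (Q - {v}) f" using min[of "Q - {v}"] v by blast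
    have "card (f ` nbrs_in adj Q v) < card (L v)"
      using less card_image_le[of "nbrs_in adj Q v" f] finQ by (simp add: nbrs_in_def)
    then have "\<not> L v \<subseteq> f ` nbrs_in adj Q v"
      using card_mono[of "f ` nbrs_in adj Q v" "L v"] finQ by (auto simp: nbrs_in_def)
    then obtain x where x: "x \<in> L v" "x \<notin> f ` nbrs_in adj Q v" by blast
    have "list_coloring adj L Q (f(v := x))"
      using f x irr sym unfolding list_coloring_def nbrs_in_def
      by (auto simp: irreflp_def dest: sympD)
    then show False using Q by blast
  qed
  have eq: "nbrs_in adj Q v = nbrs_in adj S v \<and> card (L v) = card (nbrs_in adj Q v)" if v: "v \<in> Q" for v
  proof -
    have sub: "nbrs_in adj Q v \<subseteq> nbrs_in adj S v" and fS: "finite (nbrs_in adj S v)"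
      using Q fin by (auto simp: nbrs_in_def)
    have "card (nbrs_in adj S v) \<le> card (nbrs_in adj Q v)"
      using tight[OF v] L(2)[of v] v Q by fastforce
    then have "nbrs_in adj Q v = nbrs_in adj S v" using card_seteq[OF fS sub] by blast
    then show ?thesis using tight[OF v] L(2)[of v] v Q by fastforce
  qed
  show ?thesis
  proof (rule that[of Q])
    show "Q \<noteq> {}" using Q by (auto simp: list_coloring_def)
    have "y \<in> Q" if "x \<in> Q" "y \<in> S" "adj x y" for x y
    proof -
      have "y \<in> nbrs_in adj S x" using that by (simp add: nbrs_in_def)
      then show ?thesis using eq[OF that(1)] by (auto simp: nbrs_in_def)
    qed
    then show "closed_in adj S Q" using Q by (auto simp: closed_in_def)
    show "\<nexists>f. list_coloring adj L Q f" by (rule Q(2))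
    show "\<exists>f. list_coloring adj L T f" if "T \<subset> Q" for T by (rule min[OF that])
    show "card (L v) = card (nbrs_in adj Q v)" if "v \<in> Q" for v using eq[OF that] by simp
  qed
qed

section \<open>Connectivity and precolouring in a minimal obstruction\<close>

locale uncolorable =
  fixes adj :: "'a \<Rightarrow> 'a \<Rightarrow> bool" and V :: "'a set" and L :: "'a \<Rightarrow> nat set"
  assumes fin: "finite V" and irr: "irreflp adj" and sym: "symp adj"
    and finL: "\<And>v. v \<in> V \<Longrightarrow> finite (L v)"
    and tight: "\<And>v. v \<in> V \<Longrightarrow> card (L v) = card (nbrs_in adj V v)"
    and uncol: "\<nexists>f. list_coloring adj L V f"
    and min: "\<And>T. T \<subset> V \<Longrightarrow> \<exists>f. list_coloring adj L T f"
begin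

lemma finite_nbrs: "T \<subseteq> V \<Longrightarrow> finite (nbrs_in adj T v)"
  using fin by (auto simp: nbrs_in_def intro: finite_subset)

lemma connected:
  assumes Q: "closed_in adj V Q" "Q \<noteq> {}"
  shows "Q = V"
proof (rule ccontr)
  assume "Q \<noteq> V"
  then have "Q \<subset> V" "V - Q \<subset> V" using Q by (auto simp: closed_in_def)
  then obtain f g where "list_coloring adj L Q f" "list_coloring adj L (V - Q) g"
    using min by meson
  then have "list_coloring adj L V (\<lambda>v. if v \<in> Q then f v else g v)"
    using Q sym unfolding list_coloring_def closed_in_def by (auto dest: sympD)
  then show False using uncol by blast
qed

text \<open>A vertex outside \<open>W\<close> loses at most as many colours as it has neighbours in
  \<open>W\<close>, so the reduced lists \<open>L'\<close> still dominate the degrees in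
  \<open>V - W\<close>. As \<open>f\<close> does not extend, there is a minimal obstruction
  \<open>Q\<close> inside \<open>V - W\<close>, and its lists have no slack. Hence no loss is wasted
  around \<open>Q\<close>: the neighbours in \<open>W\<close> of a vertex of \<open>Q\<close> carry
  distinct colours, all from its list. Contradictions are obtained later by choosing
  \<open>f\<close> so that a colour is wasted.\<close>

lemma precolor:
  assumes W: "W \<subseteq> V" and f: "list_coloring adj L W f"
  shows "\<exists>Q. Q \<noteq> {} \<and> closed_in adj (V - W) Q \<and>
    (\<forall>v\<in>Q. inj_on f (nbrs_in adj W v) \<and> f ` nbrs_in adj W v \<subseteq> L v)"
proof -
  define L' where "L' v = L v - f ` nbrs_in adj W v" for v
  have split: "card (nbrs_in adj V v) = card (nbrs_in adj W v) + card (nbrs_in adj (V - W) v)" for v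
  proof -
    have "nbrs_in adj V v = nbrs_in adj W v \<union> nbrs_in adj (V - W) v"
      using W by (auto simp: nbrs_in_def)
    moreover have "nbrs_in adj W v \<inter> nbrs_in adj (V - W) v = {}" by (auto simp: nbrs_in_def)
    ultimately show ?thesis using card_Un_disjoint finite_nbrs W by (metis Diff_subset)
  qed
  have cL': "card (L' v) = card (L v) - card (L v \<inter> f ` nbrs_in adj W v)" if "v \<in> V" for v
    unfolding L'_def using finL[OF that] by (metis card_Diff_subset_Int finite_Int)
  have le: "card (L v \<inter> f ` nbrs_in adj W v) \<le> card (f ` nbrs_in adj W v)"
    "card (f ` nbrs_in adj W v) \<le> card (nbrs_in adj W v)" for v
    using finite_nbrs[OF W] by (auto intro: card_mono card_image_le)
  have no: "\<nexists>g. list_coloring adj L' (V - W) g"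
  proof
    assume "\<exists>g. list_coloring adj L' (V - W) g"
    then obtain g where g: "list_coloring adj L' (V - W) g" by blast
    have gf: "g v \<noteq> f u" if "v \<in> V - W" "u \<in> W" "adj v u" for u v
      using that g by (auto simp: list_coloring_def L'_def nbrs_in_def)
    have gg: "g v \<noteq> g u" if "v \<in> V - W" "u \<in> V - W" "adj v u" for u v
      using that g by (auto simp: list_coloring_def)
    have ff: "f v \<noteq> f u" if "v \<in> W" "u \<in> W" "adj v u" for u v
      using that f by (auto simp: list_coloring_def)
    have "list_coloring adj L V (\<lambda>v. if v \<in> W then f v else g v)"
      unfolding list_coloring_def
    proof (intro conjI ballI impI)
      fix v assume "v \<in> V"
      then show "(if v \<in> W then f v else g v) \<in> L v"
        using f g by (auto simp: list_coloring_def L'_def)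
    next
      fix u v assume "u \<in> V" "v \<in> V" "adj u v"
      then show "(if u \<in> W then f u else g u) \<noteq> (if v \<in> W then f v else g v)"
        using gf[of u v] gf[of v u] gg[of u v] ff[of u v] sym by (auto dest: sympD)
    qed
    then show False using uncol by blast
  qed
  have fL': "finite (L' v)" if "v \<in> V - W" for v
    using finL that by (simp add: L'_def)
  have dL': "card (nbrs_in adj (V - W) v) \<le> card (L' v)" if "v \<in> V - W" for v
    using cL'[of v] le[of v] split[of v] tight[of v] that by simp
  have fVW: "finite (V - W)" using fin by simp
  obtain Q where Q: "Q \<noteq> {}" "closed_in adj (V - W) Q"
    "\<And>v. v \<in> Q \<Longrightarrow> card (L' v) = card (nbrs_in adj Q v)"
    using list_coloring_minimal_obstruction[OF fVW irr sym fL' dL' no] by metis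
  show ?thesis
  proof (intro exI conjI ballI)
    fix v assume v: "v \<in> Q"
    then have vV: "v \<in> V" using Q by (auto simp: closed_in_def)
    have "nbrs_in adj Q v \<subseteq> nbrs_in adj (V - W) v"
      using Q(2) by (auto simp: nbrs_in_def closed_in_def)
    then have "card (nbrs_in adj Q v) \<le> card (nbrs_in adj (V - W) v)"
      using finite_nbrs[of "V - W" v] card_mono by blast
    then have a: "card (L v \<inter> f ` nbrs_in adj W v) \<ge> card (nbrs_in adj W v)"
      using Q(3)[OF v] cL'[OF vV] le[of v] split[of v] tight[OF vV] by linarith
    then have "card (f ` nbrs_in adj W v) = card (nbrs_in adj W v)"
      "card (L v \<inter> f ` nbrs_in adj W v) = card (f ` nbrs_in adj W v)"
      using le[of v] by auto
    then show "inj_on f (nbrs_in adj W v)" "f ` nbrs_in adj W v \<subseteq> L v"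
      using eq_card_imp_inj_on[OF finite_nbrs[OF W]]
        card_subset_eq[of "f ` nbrs_in adj W v" "L v \<inter> f ` nbrs_in adj W v"]
        finite_nbrs[OF W] by (metis Int_lower2 finite_imageI inf.absorb_iff2)+
  qed (use Q in auto)
qed

end

text \<open>\<open>K\<close> is smallest over all choices of the deleted vertex, not only for
  \<open>w\<close>. So \<open>K\<close> is a component of \<open>V - {w}\<close>, and
  \<open>K\<close> together with \<open>w\<close> is an end block, or all of \<open>V\<close> when
  there is no cut vertex; the minimality expresses this without a notion of block.\<close>

locale uncolorable_leaf = uncolorable +
  fixes w :: 'a and K :: "'a set"
  assumes w: "w \<in> V" and K: "K \<noteq> {}" "closed_in adj (V - {w}) K"
    and K_min: "\<And>w' Q. w' \<in> V \<Longrightarrow> closed_in adj (V - {w'}) Q \<Longrightarrow> Q \<noteq> {} \<Longrightarrow> card K \<le> card Q"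
begin

lemma K_sub: "K \<subseteq> V" "w \<notin> K" "finite K"
  using K fin finite_subset unfolding closed_in_def by blast+

lemma K_closed: "x \<in> K \<Longrightarrow> y \<in> V \<Longrightarrow> adj x y \<Longrightarrow> y \<noteq> w \<Longrightarrow> y \<in> K"
  using K unfolding closed_in_def by blast

text \<open>Connectedness of \<open>K\<close> in the form of an induction rule: the vertices of
  \<open>K\<close> satisfying \<open>P\<close> form a closed subset of \<open>V - {w}\<close>, and a
  proper one would contradict the minimality of \<open>K\<close>.\<close>

lemma K_induct:
  assumes "k \<in> K" "P k" and step: "\<And>x y. x \<in> K \<Longrightarrow> y \<in> K \<Longrightarrow> adj x y \<Longrightarrow> P x \<Longrightarrow> P y" and y: "y \<in> K"
  shows "P y"
proof -
  define T where "T = {y \<in> K. P y}"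
  have T: "T \<subseteq> K" "k \<in> T" using assms by (auto simp: T_def)
  have "y \<in> T" if "x \<in> T" "y \<in> V - {w}" "adj x y" for x y
    using that K_closed[of x y] step[of x y] by (auto simp: T_def)
  then have "closed_in adj (V - {w}) T"
    using T K_sub unfolding closed_in_def by blast
  then have "card K \<le> card T" using K_min[OF w] T by blast
  then have "T = K" using card_seteq[OF K_sub(3) T(1)] by blast
  then show ?thesis using y by (auto simp: T_def)
qed

lemma w_nbr: obtains k where "k \<in> K" "adj k w"
proof -
  have "K \<noteq> V" using w K_sub by blast
  then have "\<not> closed_in adj V K" using connected K by blast
  then obtain x y where "x \<in> K" "y \<in> V" "adj x y" "y \<notin> K"
    using K_sub unfolding closed_in_def by blast
  then show ?thesis using K_closed[of x y] that by blast
qed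

text \<open>If deleting \<open>x\<close> disconnected \<open>V\<close>, either \<open>Q\<close> or
  its complement would miss \<open>w\<close>. The part of that set inside \<open>K\<close> is closed
  and lacks \<open>x\<close>, hence is smaller than \<open>K\<close> and must be empty. But every
  neighbour of \<open>x\<close> other than \<open>w\<close> lies in \<open>K\<close>, so the set has
  no edge to \<open>x\<close> and is closed in the connected set \<open>V\<close>.\<close>

lemma not_cut:
  assumes x: "x \<in> K" and Q: "closed_in adj (V - {x}) Q" "Q \<noteq> {}"
  shows "Q = V - {x}"
proof -
  have no: False if Q: "closed_in adj (V - {x}) Q" "Q \<noteq> {}" and wQ: "w \<notin> Q" for Q
  proof -
    have QV: "Q \<subseteq> V - {x}" and cl: "\<And>y z. y \<in> Q \<Longrightarrow> z \<in> V \<Longrightarrow> adj y z \<Longrightarrow> z \<noteq> x \<Longrightarrow> z \<in> Q"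
      using Q unfolding closed_in_def by blast+
    have "closed_in adj (V - {x}) (Q \<inter> K)"
      unfolding closed_in_def using QV cl K_closed wQ by blast
    moreover have "card (Q \<inter> K) < card K"
      using x QV K_sub by (intro psubset_card_mono) auto
    ultimately have disj: "Q \<inter> K = {}"
      using K_min[of x "Q \<inter> K"] x K_sub by fastforce
    have "z \<in> Q" if "y \<in> Q" "z \<in> V" "adj y z" for y z
    proof (cases "z = x")
      case True
      then have "y \<in> K" using K_closed[OF x, of y] that QV wQ sym by (metis DiffD1 subsetD sympD)
      then show ?thesis using that disj by blast
    qed (use cl that in blast)
    then have "closed_in adj V Q" using QV unfolding closed_in_def by blast
    then show False using connected Q w wQ by blast
  qed
  have "w \<noteq> x" using x K_sub by blast
  show ?thesis
  proof (rule ccontr)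
    assume ne: "Q \<noteq> V - {x}"
    have "closed_in adj (V - {x}) (V - {x} - Q)"
      using Q sym unfolding closed_in_def by (blast dest: sympD)
    moreover have "V - {x} - Q \<noteq> {}" using ne Q unfolding closed_in_def by blast
    ultimately show False using no[of Q] no[of "V - {x} - Q"] Q by blast
  qed
qed

text \<open>Precolour only \<open>x\<close>, with a colour \<open>i\<close> of its list. Since
  \<open>V - {x}\<close> is connected, the set without slack is all of \<open>V - {x}\<close>, so
  every neighbour of \<open>x\<close> has \<open>i\<close> in its list.\<close>

lemma L_mono:
  assumes x: "x \<in> K" and z: "z \<in> V" "adj x z"
  shows "L x \<subseteq> L z"
proof
  fix i assume i: "i \<in> L x"
  have xV: "x \<in> V" using x K_sub by blast
  have "list_coloring adj L {x} (\<lambda>_. i)"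
    using i irr by (auto simp: list_coloring_def irreflp_def)
  then obtain Q where Q: "Q \<noteq> {}" "closed_in adj (V - {x}) Q"
    "\<forall>v\<in>Q. (\<lambda>_. i) ` nbrs_in adj {x} v \<subseteq> L v"
    using precolor[of "{x}" "\<lambda>_. i"] xV by auto
  have "z \<noteq> x" using z irr by (auto simp: irreflp_def)
  then have "z \<in> Q" using not_cut[OF x Q(2,1)] z by blast
  then show "i \<in> L z" using Q(3) z sym by (auto simp: nbrs_in_def dest: sympD)
qed

lemma L_const: "x \<in> K \<Longrightarrow> y \<in> K \<Longrightarrow> L x = L y"
  using K_induct[of x "\<lambda>y. L y = L x" y] L_mono K_sub sym by (metis subset_antisym subsetD sympD)

text \<open>As in Zajac's proof of Brooks' theorem, the neighbours of the end of a longest path span a cycle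
  \<open>C\<close>. Some vertex \<open>y\<close> of \<open>C\<close> with a neighbour \<open>x\<close> outside \<open>C\<close> is preceded on \<open>C\<close> by a vertex \<open>z\<close>
  with no neighbour outside; giving \<open>z\<close> the colour of \<open>x\<close> leaves slack at \<open>y\<close>.\<close>

lemma not_cubic:
  assumes full: "\<And>v. v \<in> K \<Longrightarrow> L v = {0, 1, 2}" and sub: "\<And>v. v \<in> V \<Longrightarrow> L v \<subseteq> {0, 1, 2}"
    and tri: "\<And>x y z. adj x y \<Longrightarrow> adj y z \<Longrightarrow> \<not> adj x z"
  shows False
proof -
  \<comment> \<open>Only the last vertex of the path is \<open>w\<close>. The free end
    \<open>v 0\<close> lies in \<open>K\<close>, so a neighbour of it off the path lies in
    \<open>K\<close> as well and would prolong the path.\<close>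
  define P where "P m v \<longleftrightarrow> v m = w \<and> (\<forall>i<m. v i \<in> K) \<and> inj_on v {..m} \<and> (\<forall>i<m. adj (v i) (v (Suc i)))"
    for m :: nat and v :: "nat \<Rightarrow> 'a"
  obtain k where k: "k \<in> K" "adj k w" by (rule w_nbr)
  have kw: "k \<noteq> w" using k K_sub by blast
  have "P 1 (\<lambda>i. if i = 0 then k else w)"
    using k kw by (auto simp: P_def inj_on_def)
  then have ex: "\<exists>v. P 1 v" by blast
  have bd: "m \<le> card V" if "\<exists>v. P m v" for m
  proof -
    from that obtain v where v: "P m v" by blast
    have "v i \<in> V" if "i \<le> m" for i
      using v that K_sub w unfolding P_def by (metis le_neq_implies_less subsetD)
    then have "card (v ` {..m}) \<le> card V" using fin by (intro card_mono) auto
    then show ?thesis using v card_image[of v "{..m}"] by (simp add: P_def)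
  qed
  define m where "m = (GREATEST m. \<exists>v. P m v)"
  have "\<exists>v. P m v" unfolding m_def by (rule GreatestI_nat[of "\<lambda>m. \<exists>v. P m v", OF ex]) (use bd in blast)
  then obtain v where v: "P m v" by blast
  have m_max: "m' \<le> m" if "P m' v'" for m' v'
    unfolding m_def by (rule Greatest_le_nat[of "\<lambda>m. \<exists>v. P m v" _ "card V"]) (use bd that in blast)+
  have m1: "1 \<le> m" using m_max ex by blast
  have vm: "v m = w" and vK: "\<And>i. i < m \<Longrightarrow> v i \<in> K" and inj: "inj_on v {..m}"
    and va: "\<And>i. i < m \<Longrightarrow> adj (v i) (v (Suc i))"
    using v unfolding P_def by auto
  have vV: "v i \<in> V" if "i \<le> m" for i
    using vK[of i] vm w K_sub that by (metis le_neq_implies_less subsetD)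
  have v_eq: "v i = v i' \<longleftrightarrow> i = i'" if "i \<le> m" "i' \<le> m" for i i'
    using inj that by (auto simp: inj_on_def)
  have v0: "v 0 \<in> K" using vK m1 by auto
  have on_path: "\<exists>i\<le>m. z = v i" if z: "z \<in> V" "adj (v 0) z" for z
  proof (rule ccontr)
    assume no: "\<not> ?thesis"
    then have "z \<noteq> w" using vm by auto
    then have zK: "z \<in> K" using K_closed[OF v0 z] by blast
    have "P (Suc m) (\<lambda>i. case i of 0 \<Rightarrow> z | Suc i \<Rightarrow> v i)"
      unfolding P_def
    proof (intro conjI allI impI)
      show "inj_on (\<lambda>i. case i of 0 \<Rightarrow> z | Suc i \<Rightarrow> v i) {..Suc m}"
        using no v_eq by (auto simp: inj_on_def split: nat.splits)
    next
      fix i assume "i < Suc m"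
      then show "(case i of 0 \<Rightarrow> z | Suc i \<Rightarrow> v i) \<in> K"
        using zK vK by (auto split: nat.splits)
      show "adj (case i of 0 \<Rightarrow> z | Suc i \<Rightarrow> v i) (case Suc i of 0 \<Rightarrow> z | Suc i \<Rightarrow> v i)"
        using \<open>i < Suc m\<close> va z sym by (auto split: nat.splits dest: sympD)
    qed (use vm in auto)
    then show False using m_max[of "Suc m"] by auto
  qed
  define J where "J = {i. i \<le> m \<and> adj (v 0) (v i)}"
  have "1 \<in> J" using va[of 0] m1 by (auto simp: J_def)
  have "finite J" by (simp add: J_def)
  have nbJ: "nbrs_in adj V (v 0) = v ` J"
    using on_path vV unfolding nbrs_in_def J_def by blast
  have "inj_on v J" using inj by (rule inj_on_subset) (auto simp: J_def)
  then have cardJ: "card J = 3"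
    using tight[of "v 0"] full[OF v0] v0 K_sub by (simp add: nbJ card_image subset_iff)
  define j where "j = Max J"
  have jJ: "j \<in> J" and j_max: "\<And>i. i \<in> J \<Longrightarrow> i \<le> j"
    using \<open>1 \<in> J\<close> \<open>finite J\<close> Max_in[of J] Max_ge[of J] unfolding j_def by blast+
  have "0 \<notin> J" using irr by (auto simp: J_def irreflp_def)
  have "\<not> J \<subseteq> {1, j}" using cardJ card_mono[of "{1,j}" J] by (auto simp: card_insert_if split: if_splits)
  then obtain k where kJ: "k \<in> J" "k \<noteq> 1" "k \<noteq> j" by blast
  have kk: "1 < k" "k < j"
    using kJ j_max[of k] \<open>0 \<notin> J\<close> by (cases k; auto)+
  have jm: "j \<le> m" and a0j: "adj (v 0) (v j)" and a0k: "adj (v 0) (v k)"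
    using jJ kJ by (auto simp: J_def)
  define C where "C = v ` {..j}"
  have CV: "C \<subseteq> V" using vV jm by (auto simp: C_def)
  show False
  proof (cases "C = V")
    \<comment> \<open>The cycle is Hamiltonian, so there is no vertex outside. The neighbours
      \<open>v 1\<close> and \<open>v j\<close> of \<open>v 0\<close> are non-adjacent for lack of
      triangles and can both take colour 0, which wastes a loss at \<open>v 0\<close>. The third
      neighbour \<open>v k\<close> ties \<open>v 0\<close> to the remaining vertices, so the set
      without slack contains \<open>v 0\<close>.\<close>
    case True
    have j3: "3 \<le> j" using kk by simp
    \<comment> \<open>The vertex \<open>w\<close> is not in \<open>K\<close>; it inherits the full
      list from a neighbour in \<open>K\<close>.\<close>
    have "L (v i) = {0,1,2}" if "i \<le> m" for i
    proof (cases "i = m")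
      case True
      obtain x where "x \<in> K" "adj x w" by (rule w_nbr)
      then show ?thesis using L_mono[of x w] full[of x] sub[of w] w vm True by auto
    qed (use that vK full in auto)
    moreover have "\<not> adj (v 1) (v j)" "\<not> adj (v j) (v 1)"
      using tri[of "v 0" "v 1" "v j"] tri[of "v 0" "v j" "v 1"] va[of 0] m1 a0j by auto
    ultimately have "list_coloring adj L {v 1, v j} (\<lambda>_. 0)"
      using m1 jm irr by (auto simp: list_coloring_def irreflp_def)
    then obtain Q where Q: "Q \<noteq> {}" "closed_in adj (V - {v 1, v j}) Q"
      "\<forall>x\<in>Q. inj_on (\<lambda>_. 0::nat) (nbrs_in adj {v 1, v j} x)"
      using precolor[of "{v 1, v j}" "\<lambda>_. 0"] vV m1 jm by auto
    have S: "v i \<in> V - {v 1, v j}" if "i \<le> m" "i \<noteq> 1" "i \<noteq> j" for i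
      using that vV v_eq[of i 1] v_eq[of i j] m1 jm by auto
    obtain x where x: "x \<in> Q" using Q by blast
    then have "x \<in> V" "x \<noteq> v 1" "x \<noteq> v j" using Q by (auto simp: closed_in_def)
    then obtain i where i: "x = v i" "i \<le> j" "i \<noteq> 1" "i \<noteq> j"
      using True by (auto simp: C_def)
    have "v 0 \<in> Q"
    proof (cases "i = 0")
      case False
      have "v k \<in> Q"
        by (rule closed_in_path[OF sym Q(2), where l = 2 and m = "j - 1" and k = i])
          (use S va jm x i False kk in auto)
      then show ?thesis
        using Q(2) S[of 0] a0k sym j3 by (auto simp: closed_in_def dest: sympD)
    qed (use x i in simp)
    then have "inj_on (\<lambda>_. 0::nat) (nbrs_in adj {v 1, v j} (v 0))" using Q(3) by blast
    moreover have "v 1 \<in> nbrs_in adj {v 1, v j} (v 0)" "v j \<in> nbrs_in adj {v 1, v j} (v 0)"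
      using va[of 0] m1 a0j by (auto simp: nbrs_in_def)
    ultimately show False using v_eq[of 1 j] m1 jm j3 by (auto simp: inj_on_def)
  next
    case False
    define out where "out i \<longleftrightarrow> (\<exists>x\<in>V - C. adj (v i) x)" for i
    have "\<not> closed_in adj V C" using connected[of C] False by (auto simp: C_def)
    then obtain i where i: "i \<le> j" "out i"
      using CV by (auto simp: closed_in_def C_def out_def)
    define l where "l = (LEAST i. out i)"
    have l: "out l" "l \<le> j" and l_min: "\<And>i. i < l \<Longrightarrow> \<not> out i"
      unfolding l_def using i LeastI[of out i] Least_le[of out i] not_less_Least by auto
    have "\<not> out 0"
    proof
      assume "out 0"
      then obtain x where x: "x \<in> V" "x \<notin> C" "adj (v 0) x" by (auto simp: out_def)
      then obtain i where "i \<le> m" "x = v i" using on_path by blast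
      then show False using x j_max[of i] by (auto simp: J_def C_def)
    qed
    then have "l \<noteq> 0" using l(1) by metis
    then obtain l' where l': "l = Suc l'" by (cases l) auto
    obtain x where x: "x \<in> V" "x \<notin> C" "adj (v l) x" using l by (auto simp: out_def)
    obtain f where f: "list_coloring adj L (V - C) f"
      using min[of "V - C"] CV by (auto simp: C_def)
    have l'out: "\<not> adj (v l') y" "\<not> adj y (v l')" if "y \<in> V - C" for y
      using l_min[of l'] l' that sym by (auto simp: out_def dest: sympD)
    define W where "W = insert (v l') (V - C)"
    have l'C: "v l' \<in> C" using l l' by (auto simp: C_def)
    have "L (v l') = {0,1,2}" using full vK[of l'] l l' jm by simp
    moreover have "f x \<in> L x" using f x unfolding list_coloring_def by blast
    ultimately have "f x \<in> L (v l')" using sub[OF x(1)] by blast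
    define g where "g = f(v l' := f x)"
    have "list_coloring adj L W g"
      unfolding list_coloring_def
    proof (intro conjI ballI impI)
      fix y assume "y \<in> W"
      then show "g y \<in> L y" using f \<open>f x \<in> L (v l')\<close> by (auto simp: list_coloring_def W_def g_def)
    next
      fix y z assume "y \<in> W" "z \<in> W" "adj y z"
      then have "y \<in> V - C" "z \<in> V - C"
        using l'out irr unfolding W_def irreflp_def by blast+
      then show "g y \<noteq> g z" using f \<open>adj y z\<close> l'C by (auto simp: list_coloring_def g_def)
    qed
    moreover have "W \<subseteq> V" using CV l'C by (auto simp: W_def)
    ultimately obtain Q where Q: "Q \<noteq> {}" "closed_in adj (V - W) Q"
      "\<forall>y\<in>Q. inj_on g (nbrs_in adj W y)"
      using precolor[of W g] by blast
    have VW: "V - W = C - {v l'}" using CV by (auto simp: W_def)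
    have S: "v i \<in> V - W" if "i \<le> j" "i \<noteq> l'" for i
      using that v_eq[of i l'] jm l l' by (auto simp: VW C_def)
    obtain y where y: "y \<in> Q" using Q by blast
    then have "y \<in> C" "y \<noteq> v l'" using Q VW by (auto simp: closed_in_def)
    then obtain i where i: "y = v i" "i \<le> j" "i \<noteq> l'" by (auto simp: C_def)
    \<comment> \<open>Without \<open>v l'\<close> the cycle is a path: from \<open>v l\<close> up to
      \<open>v j\<close>, then, if anything is left, across the closing edge to \<open>v 0\<close>
      and up to \<open>v (l' - 1)\<close>. Wherever \<open>Q\<close> meets this path, it can be
      followed to \<open>v l\<close>.\<close>
    have "\<exists>i. l \<le> i \<and> i \<le> j \<and> v i \<in> Q"
    proof (cases "l \<le> i")
      case False
      have "v 0 \<in> Q"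
        by (rule closed_in_path[OF sym Q(2), where l = 0 and m = "l' - 1" and k = i])
          (use S va jm y i False l l' in auto)
      then have "v j \<in> Q" using Q(2) S[of j] l l' a0j by (auto simp: closed_in_def)
      then show ?thesis using l by auto
    qed (use i y in auto)
    then obtain i where i: "l \<le> i" "i \<le> j" "v i \<in> Q" by blast
    have "v l \<in> Q"
      by (rule closed_in_path[OF sym Q(2), where l = l and m = j and k = i])
        (use S va jm i l l' in auto)
    then have "inj_on g (nbrs_in adj W (v l))" using Q(3) by blast
    moreover have "v l' \<in> nbrs_in adj W (v l)" "x \<in> nbrs_in adj W (v l)" "x \<noteq> v l'"
      using x va[of l'] l' l jm sym l'C by (auto simp: nbrs_in_def W_def dest: sympD)
    moreover have "g x = g (v l')" using x l'C by (auto simp: g_def)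
    ultimately show False unfolding inj_on_def by blast
  qed
qed

end

text \<open>Non-empty lists force positive degrees by tightness, so \<open>V - {v}\<close> is
  non-empty and there is a closed set over which to minimise.\<close>

lemma (in uncolorable) leaf_exists:
  assumes "\<And>v. v \<in> V \<Longrightarrow> L v \<noteq> {}"
  obtains w K where "uncolorable_leaf adj V L w K"
proof -
  define P where "P n \<longleftrightarrow> (\<exists>w K. w \<in> V \<and> K \<noteq> {} \<and> closed_in adj (V - {w}) K \<and> card K = n)" for n
  have "V \<noteq> {}" using uncol by (auto simp: list_coloring_def)
  then obtain v where v: "v \<in> V" by blast
  then have "nbrs_in adj V v \<noteq> {}" using tight[OF v] assms[OF v] finL[OF v] by auto
  then have "V - {v} \<noteq> {}" using irr by (auto simp: nbrs_in_def irreflp_def)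
  moreover have "closed_in adj (V - {v}) (V - {v})" by (auto simp: closed_in_def)
  ultimately have "P (card (V - {v}))" using v unfolding P_def by (intro exI[of _ v] exI[of _ "V - {v}"]) simp
  then have P: "P (LEAST n. P n)" by (rule LeastI)
  then obtain w K where K: "w \<in> V" "K \<noteq> {}" "closed_in adj (V - {w}) K" "card K = (LEAST n. P n)"
    unfolding P_def by blast
  have "card K \<le> card Q" if "w' \<in> V" "closed_in adj (V - {w'}) Q" "Q \<noteq> {}" for w' Q
    unfolding K(4) by (rule Least_le) (use that in \<open>auto simp: P_def\<close>)
  with K have "uncolorable_leaf adj V L w K" by unfold_locales
  then show ?thesis by (rule that)
qed

lemma card_2_eqI: "card A = 2 \<Longrightarrow> a \<in> A \<Longrightarrow> b \<in> A \<Longrightarrow> a \<noteq> b \<Longrightarrow> A = {a, b}"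
  by (auto simp: card_2_iff)

section \<open>End blocks with lists of size two\<close>

context uncolorable_leaf
begin

lemma leaf_is_even_path:
  assumes two: "\<And>v. v \<in> K \<Longrightarrow> card (L v) = 2"
  obtains m v where "v 0 = w" "inj_on v {..m}" "K = v ` {1..m}"
    "\<And>i. i < m \<Longrightarrow> adj (v i) (v (Suc i))" "adj (v m) (v 0)" "even m" "2 \<le> m"
proof -
  define P where "P m v \<longleftrightarrow> v 0 = w \<and> (\<forall>i\<in>{1..m}. v i \<in> K) \<and> inj_on v {..m} \<and> (\<forall>i<m. adj (v i) (v (Suc i)))"
    for m :: nat and v :: "nat \<Rightarrow> 'a"
  have card2: "card (nbrs_in adj V y) = 2" if "y \<in> K" for y
    using tight[of y] two[OF that] that K_sub by auto
  obtain k where k: "k \<in> K" "adj k w" by (rule w_nbr)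
  have kw: "k \<noteq> w" using k K_sub by blast
  have "P 1 (\<lambda>i. if i = 0 then w else k)"
    using k kw sym by (auto simp: P_def inj_on_def dest: sympD)
  then have ex: "\<exists>v. P 1 v" by blast
  have bd: "m \<le> card V" if "\<exists>v. P m v" for m
  proof -
    from that obtain v where v: "P m v" by blast
    have "v i \<in> V" if "i \<le> m" for i
      using v that K_sub w unfolding P_def by (cases "i = 0") auto
    then have "card (v ` {..m}) \<le> card V" using fin by (intro card_mono) auto
    then show ?thesis using v card_image[of v "{..m}"] by (simp add: P_def)
  qed
  define m where "m = (GREATEST m. \<exists>v. P m v)"
  have "\<exists>v. P m v" unfolding m_def by (rule GreatestI_nat[of "\<lambda>m. \<exists>v. P m v", OF ex]) (use bd in blast)
  then obtain v where v: "P m v" by blast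
  have m_max: "m' \<le> m" if "P m' v'" for m' v'
    unfolding m_def by (rule Greatest_le_nat[of "\<lambda>m. \<exists>v. P m v" _ "card V"]) (use bd that in blast)+
  have m1: "1 \<le> m" using m_max ex by blast
  have v0: "v 0 = w" and vK: "\<And>i. 1 \<le> i \<Longrightarrow> i \<le> m \<Longrightarrow> v i \<in> K" and inj: "inj_on v {..m}"
    and va: "\<And>i. i < m \<Longrightarrow> adj (v i) (v (Suc i))"
    using v unfolding P_def by auto
  have vV: "v i \<in> V" if "i \<le> m" for i
    using vK[of i] v0 w K_sub that by (cases "i = 0") auto
  have v_eq: "v i = v i' \<longleftrightarrow> i = i'" if "i \<le> m" "i' \<le> m" for i i'
    using inj that by (auto simp: inj_on_def)
  have nb: "nbrs_in adj V (v i) = {v (i - 1), v (Suc i)}" if i: "1 \<le> i" "i < m" for i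
  proof -
    have "adj (v i) (v (i - 1))" using va[of "i - 1"] i sympD[OF sym, of "v (i - 1)" "v i"] by simp
    then have "v (i - 1) \<in> nbrs_in adj V (v i)" "v (Suc i) \<in> nbrs_in adj V (v i)"
      using va[of i] vV[of "i - 1"] vV[of "Suc i"] i by (auto simp: nbrs_in_def)
    moreover have "v (i - 1) \<noteq> v (Suc i)" using v_eq[of "i - 1" "Suc i"] i by simp
    ultimately show ?thesis using card_2_eqI card2[OF vK[of i]] i by simp
  qed
  obtain m' where m': "m = Suc m'" using m1 by (cases m) auto
  have am: "adj (v m) (v m')" using va[of m'] m' sympD[OF sym, of "v m'" "v m"] by simp
  have cm: "card (nbrs_in adj V (v m)) = 2" using card2 vK m1 by simp
  have "nbrs_in adj V (v m) \<noteq> {v m'}" using cm by auto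
  then obtain z where z: "z \<in> V" "adj (v m) z" "z \<noteq> v m'"
    using am vV[of m'] m' by (auto simp: nbrs_in_def)
  have zw: "z = w"
  proof (rule ccontr)
    assume zw: "z \<noteq> w"
    then have zK: "z \<in> K" using K_closed[of "v m" z] vK[of m] m1 z by auto
    have "\<exists>i\<le>m. z = v i"
    proof (rule ccontr)
      assume no: "\<not> ?thesis"
      have "P (Suc m) (v(Suc m := z))"
        unfolding P_def
      proof (intro conjI)
        show "inj_on (v(Suc m := z)) {..Suc m}"
          using inj no by (auto simp: inj_on_def le_Suc_eq)
        show "\<forall>i<Suc m. adj ((v(Suc m := z)) i) ((v(Suc m := z)) (Suc i))"
          using va z by (auto simp: less_Suc_eq)
      qed (use v0 vK zK in \<open>auto simp: le_Suc_eq\<close>)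
      then show False using m_max[of "Suc m"] by auto
    qed
    then obtain i where i: "i \<le> m" "z = v i" by blast
    have "i \<noteq> m" using z i irr by (auto simp: irreflp_def)
    moreover have "i \<noteq> m'" using z i by auto
    moreover have "i \<noteq> 0" using i zw v0 by metis
    ultimately have i': "1 \<le> i" "i < m'" using i m' by auto
    have "v m \<in> nbrs_in adj V (v i)" using z i vV[of m] sym by (auto simp: nbrs_in_def dest: sympD)
    then show False using nb[of i] i' m' v_eq[of m "i - 1"] v_eq[of m "Suc i"] by auto
  qed
  have m2: "2 \<le> m" using z zw v0 m' by (cases m') auto
  have nbm: "nbrs_in adj V (v m) = {v m', w}"
  proof -
    have "v m' \<in> nbrs_in adj V (v m)" "w \<in> nbrs_in adj V (v m)"
      using z zw am vV[of m'] m' by (auto simp: nbrs_in_def)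
    then show ?thesis using card_2_eqI[OF cm] z zw by blast
  qed
  have KP: "y \<in> v ` {1..m}" if "y \<in> K" for y
  proof (rule K_induct[OF vK[of 1] _ _ that])
    fix x y assume xy: "x \<in> K" "y \<in> K" "adj x y" "x \<in> v ` {1..m}"
    then obtain i where i: "1 \<le> i" "i \<le> m" "x = v i" by auto
    have y: "y \<in> nbrs_in adj V (v i)" "y \<noteq> v 0" using xy i K_sub v0 by (auto simp: nbrs_in_def)
    show "y \<in> v ` {1..m}"
    proof (cases "i = m")
      case True
      then have ym: "y = v m'" using y nbm v0 by auto
      then have "m' \<noteq> 0" using y by metis
      with ym show ?thesis using m' by auto
    next
      case False
      then have "y = v (i - 1) \<or> y = v (Suc i)" using nb[of i] i y by auto
      moreover have "v (i - 1) \<in> v ` {1..m} \<or> i = 1" using i by (cases "i = 1") (auto intro!: imageI)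
      ultimately show ?thesis using y i False by auto
    qed
  qed (use m1 in auto)
  then have K_eq: "K = v ` {1..m}" using vK by auto
  have "even m"
  proof (rule ccontr)
    assume odd: "odd m"
    have "V - K \<subset> V" using K K_sub by blast
    then obtain f where f: "list_coloring adj L (V - K) f" using min by blast
    obtain \<alpha> \<beta> where L: "L (v 1) = {\<alpha>, \<beta>}" "\<alpha> \<noteq> \<beta>"
      using two[of "v 1"] vK[of 1] m1 by (auto simp: card_2_iff)
    obtain c d where cd: "L (v 1) = {c, d}" "c \<noteq> d" "f w \<noteq> c"
      using that[of \<alpha> \<beta>] that[of \<beta> \<alpha>] L by (metis insert_commute)
    define ix where "ix y = (THE i. i \<in> {1..m} \<and> v i = y)" for y
    have ix: "ix (v i) = i" if "1 \<le> i" "i \<le> m" for i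
      unfolding ix_def using that v_eq by (intro the_equality) auto
    define g where "g y = (if y \<in> K then if odd (ix y) then c else d else f y)" for y
    have gi: "g (v i) = (if odd i then c else d)" if "1 \<le> i" "i \<le> m" for i
      using that vK ix by (simp add: g_def)
    have gw: "g w \<noteq> c" using K_sub cd by (simp add: g_def)
    have gK: "g x \<noteq> g y" if x: "x \<in> K" and y: "y \<in> V" "adj x y" for x y
    proof -
      obtain i where i: "1 \<le> i" "i \<le> m" "x = v i" using x K_eq by auto
      have y': "y \<in> nbrs_in adj V (v i)" using y i by (auto simp: nbrs_in_def)
      show ?thesis
      proof (cases "i = m")
        case True
        then have "y = v m' \<or> y = w" using y' nbm by auto
        then show ?thesis using gi[of m] gi[of m'] gw i True m' m2 odd cd(2) by auto
      next
        case False
        then have y'': "y = v (i - 1) \<or> y = v (Suc i)" using nb[of i] i y' by auto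
        show ?thesis
        proof (cases "i = 1")
          case True
          then show ?thesis using y'' gi[of 1] gi[of 2] gw i m2 v0 cd(2) by (auto simp: numeral_2_eq_2)
        next
          case i1: False
          then obtain k where k: "i = Suc (Suc k)" using i by (cases i; cases "i - 1") auto
          show ?thesis using y'' gi[of i] gi[of "Suc k"] gi[of "Suc i"] i False cd(2) k by auto
        qed
      qed
    qed
    have "list_coloring adj L V g"
      unfolding list_coloring_def
    proof (intro conjI ballI impI)
      fix y assume y: "y \<in> V"
      show "g y \<in> L y"
      proof (cases "y \<in> K")
        case True
        then have "L y = {c, d}" using L_const[of "v 1" y] vK[of 1] m1 cd by auto
        then show ?thesis using True by (auto simp: g_def)
      next
        case False
        then show ?thesis using f y by (auto simp: g_def list_coloring_def)
      qed
    next
      fix x y assume xy: "x \<in> V" "y \<in> V" "adj x y"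
      show "g x \<noteq> g y"
      proof (cases "x \<in> K \<or> y \<in> K")
        case True
        then show ?thesis using gK[of x y] gK[of y x] xy sym by (auto dest: sympD)
      next
        case False
        then show ?thesis using f xy by (auto simp: g_def list_coloring_def)
      qed
    qed
    then show False using uncol by blast
  qed
  then show ?thesis
    using that[of v m] v0 inj K_eq va z zw m2 by simp
qed

end

section \<open>Splitting a colour set into blocks\<close>

text \<open>Elements outside \<open>T\<close> are spent first. Either they suffice, or all of
  \<open>Y - T\<close> is used and \<open>T\<close> loses only \<open>n - card (Y - T)\<close>
  elements.\<close>

lemma subset_of_card_outside:
  assumes fin: "finite Y" "finite T" and n: "n \<le> card Y"
  obtains E where "E \<subseteq> Y" "card E = n" "T \<inter> E = {} \<or> card (T \<union> Y) \<le> card (T - E) + n"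
proof (cases "n \<le> card (Y - T)")
  case True
  then obtain E where "E \<subseteq> Y - T" "card E = n" using obtain_subset_with_card_n by metis
  then show ?thesis using that[of E] by blast
next
  case False
  have cY: "card Y = card (Y - T) + card (Y \<inter> T)"
    using fin by (metis Int_commute add.commute card_Int_Diff)
  then obtain E where E: "E \<subseteq> Y \<inter> T" "card E = n - card (Y - T)"
    using obtain_subset_with_card_n[of "n - card (Y - T)" "Y \<inter> T"] n by (metis le_diff_conv add.commute)
  have finE: "finite E" using E fin finite_subset by blast
  have "card ((Y - T) \<union> E) = n"
    using E False fin finE by (subst card_Un_disjoint) auto
  moreover have "card (T - ((Y - T) \<union> E)) = card T - card E"
    using E finE by (subst card_Diff_subset[symmetric]) (auto intro!: arg_cong[where f = card])
  moreover have "card (T \<union> Y) = card T + card (Y - T)"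
    using fin by (subst card_Un_disjoint[symmetric]) (auto intro!: arg_cong[where f = card])
  moreover have "card E \<le> card T" using E fin by (intro card_mono) auto
  ultimately show ?thesis
    using that[of "(Y - T) \<union> E"] E False by auto
qed

text \<open>A Hall-type selection with demands \<open>2 * n\<close>, \<open>n\<close>,
  \<open>n\<close>, carried out greedily: \<open>C\<close> is taken where it costs
  \<open>X \<union> Y\<close> least, then \<open>B\<close> where it costs \<open>X\<close> least,
  and what remains of \<open>X\<close> is large enough for \<open>A\<close>.\<close>

lemma disjoint_representatives:
  assumes fin: "finite X" "finite Y" "finite Z"
    and card: "3 * n \<le> card X" "3 * n \<le> card Y" "3 * n \<le> card Z" "4 * n \<le> card (X \<union> Y \<union> Z)"
  obtains A B C where "A \<subseteq> X" "B \<subseteq> Y" "C \<subseteq> Z" "card A = 2 * n" "card B = n" "card C = n"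
    "A \<inter> B = {}" "A \<inter> C = {}" "B \<inter> C = {}"
proof -
  obtain C where C: "C \<subseteq> Z" "card C = n"
    "(X \<union> Y) \<inter> C = {} \<or> card (X \<union> Y \<union> Z) \<le> card (X \<union> Y - C) + n"
    using subset_of_card_outside[of Z "X \<union> Y" n] fin card by auto
  have finC: "finite C" using C fin finite_subset by blast
  have diff: "card T - n \<le> card (T - C)" for T
    using diff_card_le_card_Diff[OF finC, of T] C by simp
  have XY: "3 * n \<le> card (X \<union> Y - C)"
  proof (cases "(X \<union> Y) \<inter> C = {}")
    case True
    then have "X \<union> Y - C = X \<union> Y" by blast
    then show ?thesis using card(1) card_mono[of "X \<union> Y" X] fin by simp
  qed (use C card in auto)
  have Y: "n \<le> card (Y - C)" using diff[of Y] card by linarith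
  obtain B where B: "B \<subseteq> Y - C" "card B = n"
    "(X - C) \<inter> B = {} \<or> card ((X - C) \<union> (Y - C)) \<le> card (X - C - B) + n"
    using subset_of_card_outside[of "Y - C" "X - C" n] fin Y by auto
  have "2 * n \<le> card (X - C - B)"
  proof (cases "(X - C) \<inter> B = {}")
    case True
    then have "X - C - B = X - C" by blast
    then show ?thesis using diff[of X] card by simp
  next
    case False
    moreover have "(X - C) \<union> (Y - C) = X \<union> Y - C" by blast
    ultimately show ?thesis using B XY by simp
  qed
  then obtain A where "A \<subseteq> X - C - B" "card A = 2 * n"
    using obtain_subset_with_card_n by metis
  then show ?thesis using B C by (intro that[of A B C]) auto
qed

section \<open>Palettes cut into equal blocks that avoid given sets\<close>

definition color_blocks :: "nat \<Rightarrow> nat \<Rightarrow> (nat \<Rightarrow> nat set) \<Rightarrow> bool" where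
  "color_blocks n m K \<longleftrightarrow>
     (\<forall>i<m. K i \<subseteq> {..<m * n} \<and> card (K i) = n) \<and> (\<forall>i<m. \<forall>j<m. i \<noteq> j \<longrightarrow> K i \<inter> K j = {})"

lemma color_blocks_extend:
  assumes xs: "sorted_wrt (\<lambda>A B. A \<inter> B = {}) xs" "\<And>A. A \<in> set xs \<Longrightarrow> A \<subseteq> {..<m * n} \<and> card A = n"
    and len: "length xs \<le> m"
  obtains K where "color_blocks n m K" "\<And>i. i < length xs \<Longrightarrow> K i = xs ! i"
proof -
  have "\<exists>ys. length ys = m \<and> sorted_wrt (\<lambda>A B. A \<inter> B = {}) ys \<and>
      (\<forall>A\<in>set ys. A \<subseteq> {..<m * n} \<and> card A = n) \<and> (\<forall>i<length xs. ys ! i = xs ! i)"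
    using assms
  proof (induction "m - length xs" arbitrary: xs)
    case 0
    then show ?case by (intro exI[of _ xs]) auto
  next
    case (Suc d)
    have fin: "finite A" if "A \<in> set xs" for A
      using Suc.prems(2)[OF that] finite_subset[of A "{..<m * n}"] by blast
    have "card (\<Union>(set xs)) \<le> (\<Sum>A\<in>set xs. card A)"
      by (rule card_Union_le_sum_card)
    also have "\<dots> = card (set xs) * n" using Suc.prems(2) by simp
    also have "\<dots> \<le> length xs * n" using card_length by (intro mult_right_mono) auto
    finally have c: "card (\<Union>(set xs)) \<le> length xs * n" .
    have "Suc (length xs) * n \<le> m * n" using Suc.hyps by (intro mult_right_mono) auto
    then have "n \<le> card {..<m * n} - card (\<Union>(set xs))" using c by simp
    also have "\<dots> \<le> card ({..<m * n} - \<Union>(set xs))"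
      by (rule diff_card_le_card_Diff) (use fin in auto)
    finally obtain A where A: "A \<subseteq> {..<m * n} - \<Union>(set xs)" "card A = n"
      using obtain_subset_with_card_n by metis
    have "\<exists>ys. length ys = m \<and> sorted_wrt (\<lambda>A B. A \<inter> B = {}) ys \<and>
      (\<forall>A\<in>set ys. A \<subseteq> {..<m * n} \<and> card A = n) \<and> (\<forall>i<length (xs @ [A]). ys ! i = (xs @ [A]) ! i)"
    proof (rule Suc.hyps(1))
      show "sorted_wrt (\<lambda>A B. A \<inter> B = {}) (xs @ [A])"
        using Suc.prems(1) A by (auto simp: sorted_wrt_append)
      show "X \<subseteq> {..<m * n} \<and> card X = n" if "X \<in> set (xs @ [A])" for X
        using that Suc.prems(2)[of X] A by auto
    qed (use Suc in auto)
    then show ?case by (auto simp: nth_append split: if_splits)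
  qed
  then obtain ys where ys: "length ys = m" "sorted_wrt (\<lambda>A B. A \<inter> B = {}) ys"
    "\<forall>A\<in>set ys. A \<subseteq> {..<m * n} \<and> card A = n" "\<forall>i<length xs. ys ! i = xs ! i" by blast
  have "ys ! i \<inter> ys ! j = {}" if "i < m" "j < m" "i \<noteq> j" for i j
    using sorted_wrt_nth_less[OF ys(2), of i j] sorted_wrt_nth_less[OF ys(2), of j i] that ys(1)
    by (metis Int_commute linorder_neqE_nat)
  then have "color_blocks n m ((!) ys)"
    using ys unfolding color_blocks_def by auto
  then show ?thesis using that ys by blast
qed

lemma disjoint_list_split:
  assumes "sorted_wrt (\<lambda>A B. A \<inter> B = {}) (xs @ A # ys)" "B \<subseteq> A" "C \<subseteq> A" "B \<inter> C = {}"
  shows "sorted_wrt (\<lambda>A B. A \<inter> B = {}) (xs @ B # C # ys)"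
proof -
  have "X \<inter> B = {}" "X \<inter> C = {}" if "X \<inter> A = {}" for X using that assms(2,3) by blast+
  moreover have "B \<inter> X = {}" "C \<inter> X = {}" if "A \<inter> X = {}" for X using that assms(2,3) by blast+
  ultimately show ?thesis using assms(1,4) by (simp add: sorted_wrt_append)
qed

lemma halve:
  assumes "card A = 2 * n"
  obtains B C where "B \<subseteq> A" "C \<subseteq> A" "B \<inter> C = {}" "card B = n" "card C = n"
proof (cases "n = 0")
  case False
  then have "finite A" using assms by (intro card_ge_0_finite) simp
  obtain B where B: "B \<subseteq> A" "card B = n" using assms obtain_subset_with_card_n[of n A] by auto
  then have "card (A - B) = n" using assms \<open>finite A\<close> card_Diff_subset[of B A] finite_subset by fastforce
  then show ?thesis using that[of B "A - B"] B by blast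
qed (use that[of "{}" "{}"] in simp)

text \<open>The two sets exclude at most \<open>8 * n\<close> of the \<open>11 * n\<close> colours,
  which leaves blocks 0, 1 and 2 avoiding both. Blocks 3 and 4 avoid one set each; together with the
  blocks already chosen, that excludes at most \<open>7 * n\<close> and \<open>8 * n\<close>
  colours.\<close>

lemma blocks_two_constraints:
  assumes F: "card (F \<inter> {..<11 * n}) \<le> 4 * n" "card (F' \<inter> {..<11 * n}) \<le> 4 * n"
  obtains K where "color_blocks n 11 K" "\<And>i. i \<in> {0,1,2,3} \<Longrightarrow> K i \<inter> F = {}" "\<And>i. i \<in> {0,1,2,4} \<Longrightarrow> K i \<inter> F' = {}"
proof -
  define U where "U = {..<11 * n}"
  have U: "finite U" "card U = 11 * n" by (simp_all add: U_def)
  have pick: "\<exists>E. E \<subseteq> U - T \<and> card E = n" if "card (T \<inter> U) \<le> 10 * n" for T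
  proof -
    have "card (U - T) = card U - card (T \<inter> U)"
      using U by (metis card_Diff_subset_Int finite_Int Int_commute)
    then have "n \<le> card (U - T)" using that U by simp
    then show ?thesis using obtain_subset_with_card_n by metis
  qed
  have un: "card ((A \<union> B) \<inter> U) \<le> card (A \<inter> U) + n" if "B \<subseteq> U - Y" "card B = n" for A B Y
  proof -
    have "(A \<union> B) \<inter> U = (A \<inter> U) \<union> B" using that by blast
    then show ?thesis using card_Un_le[of "A \<inter> U" B] that by simp
  qed
  note F = F[folded U_def]
  have "(F \<union> F') \<inter> U = (F \<inter> U) \<union> (F' \<inter> U)" by blast
  then have 0: "card ((F \<union> F') \<inter> U) \<le> 8 * n"
    using card_Un_le[of "F \<inter> U" "F' \<inter> U"] F by simp
  obtain A where A: "A \<subseteq> U - (F \<union> F')" "card A = n"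
    using pick[of "F \<union> F'"] 0 by force
  note unA = un[OF A]
  obtain B where B: "B \<subseteq> U - (F \<union> F' \<union> A)" "card B = n"
    using pick[of "F \<union> F' \<union> A"] unA[of "F \<union> F'"] 0 by force
  note unB = un[OF B]
  obtain C where C: "C \<subseteq> U - (F \<union> F' \<union> A \<union> B)" "card C = n"
    using pick[of "F \<union> F' \<union> A \<union> B"] unA[of "F \<union> F'"] unB[of "F \<union> F' \<union> A"] 0 by force
  note unC = un[OF C]
  obtain D where D: "D \<subseteq> U - (F \<union> A \<union> B \<union> C)" "card D = n"
    using pick[of "F \<union> A \<union> B \<union> C"] unA[of F] unB[of "F \<union> A"] unC[of "F \<union> A \<union> B"] F by force
  note unD = un[OF D]
  obtain E where E: "E \<subseteq> U - (F' \<union> A \<union> B \<union> C \<union> D)" "card E = n"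
    using pick[of "F' \<union> A \<union> B \<union> C \<union> D"] unA[of F'] unB[of "F' \<union> A"] unC[of "F' \<union> A \<union> B"]
      unD[of "F' \<union> A \<union> B \<union> C"] F by force
  let ?xs = "[A, B, C, D, E]"
  have "A \<inter> B = {}" "A \<inter> C = {}" "A \<inter> D = {}" "A \<inter> E = {}" "B \<inter> C = {}" "B \<inter> D = {}" "B \<inter> E = {}"
    "C \<inter> D = {}" "C \<inter> E = {}" "D \<inter> E = {}" using B C D E by blast+
  then have srt: "sorted_wrt (\<lambda>A B. A \<inter> B = {}) ?xs" by simp
  have "A \<subseteq> U" "B \<subseteq> U" "C \<subseteq> U" "D \<subseteq> U" "E \<subseteq> U" using A B C D E by blast+
  then have cd: "\<forall>X\<in>set ?xs. X \<subseteq> {..<11 * n} \<and> card X = n"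
    unfolding U_def using A B C D E by simp
  obtain K where K: "color_blocks n 11 K" "\<And>i. i < length ?xs \<Longrightarrow> K i = ?xs ! i"
    by (rule color_blocks_extend[OF srt cd[rule_format]]) auto
  have Ki: "K 0 = A" "K 1 = B" "K 2 = C" "K 3 = D" "K 4 = E" using K(2) by (simp_all add: nth_Cons')
  have "A \<inter> F = {}" "B \<inter> F = {}" "C \<inter> F = {}" "D \<inter> F = {}"
    "A \<inter> F' = {}" "B \<inter> F' = {}" "C \<inter> F' = {}" "E \<inter> F' = {}" using A B C D E by blast+
  then show ?thesis by (intro that[OF K(1)]) (auto simp: Ki simp del: One_nat_def)
qed

text \<open>
  The first alternative is available when the three forbidden sets have at most \<open>3n\<close> colours in
  common, the second one when at least \<open>5n\<close> colours lie in none of them.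
\<close>

lemma blocks_three_constraints:
  assumes F: "card (F \<inter> {..<11 * n}) \<le> 4 * n" "card (F' \<inter> {..<11 * n}) \<le> 4 * n"
    "card (F'' \<inter> {..<11 * n}) \<le> 4 * n"
  obtains K where "color_blocks n 11 K"
    "(\<forall>i\<in>{2,3,6,7}. K i \<inter> F = {}) \<and> (\<forall>i\<in>{0,1,3,5}. K i \<inter> F' = {}) \<and> (\<forall>i\<in>{0,1,2,4}. K i \<inter> F'' = {}) \<or>
     (\<forall>i\<in>{0,1,3,5}. K i \<inter> F = {}) \<and> (\<forall>i\<in>{0,1,2,4}. K i \<inter> F' = {}) \<and> (\<forall>i\<in>{0,1,2,3}. K i \<inter> F'' = {})"
proof -
  define U where "U = {..<11 * n}"
  have U: "finite U" "card U = 11 * n" by (simp_all add: U_def)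
  \<comment> \<open>The forbidden sets are padded inside the palette to exactly \<open>4 * n\<close>
    colours; avoiding the larger sets is sufficient.\<close>
  have ext: "\<exists>G. T \<inter> U \<subseteq> G \<and> G \<subseteq> U \<and> card G = 4 * n" if "card (T \<inter> U) \<le> 4 * n" for T
    using exists_subset_between[of "T \<inter> U" "4 * n" U] that U by auto
  obtain G where G: "F \<inter> U \<subseteq> G" "G \<subseteq> U" "card G = 4 * n" using ext[of F] F by (auto simp: U_def)
  obtain G' where G': "F' \<inter> U \<subseteq> G'" "G' \<subseteq> U" "card G' = 4 * n" using ext[of F'] F by (auto simp: U_def)
  obtain G'' where G'': "F'' \<inter> U \<subseteq> G''" "G'' \<subseteq> U" "card G'' = 4 * n" using ext[of F''] F by (auto simp: U_def)
  have fin: "finite G" "finite G'" "finite G''" using G G' G'' U finite_subset by blast+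
  have avoid: "X \<inter> F = {}" if "X \<subseteq> U - G" for X using that G by blast
  have avoid': "X \<inter> F' = {}" if "X \<subseteq> U - G'" for X using that G' by blast
  have avoid'': "X \<inter> F'' = {}" if "X \<subseteq> U - G''" for X using that G'' by blast
  have compl: "card (U - T) = 11 * n - card T" if "T \<subseteq> U" for T
    using that U card_Diff_subset finite_subset by metis
  have un: "card (A \<union> B) + card (A \<inter> B) = card A + card B" if "finite A" "finite B" for A B :: "nat set"
    using card_Un_Int[OF that] by simp
  define T where "T = G \<inter> G' \<inter> G''"
  show ?thesis
  proof (cases "card T \<le> 3 * n")
    case True
    define X where "X = U - (G' \<union> G'')"
    define Y where "Y = U - (G \<union> G'')"
    define Z where "Z = U - (G \<union> G')"
    have 1: "3 * n \<le> card X" "3 * n \<le> card Y" "3 * n \<le> card Z"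
      unfolding X_def Y_def Z_def using compl[of "G' \<union> G''"] compl[of "G \<union> G''"] compl[of "G \<union> G'"]
        card_Un_le[of G' G''] card_Un_le[of G G''] card_Un_le[of G G'] G G' G'' by simp_all
    \<comment> \<open>The colours lying in at least two of the three sets. The two bounds on
      \<open>card D\<close> below add up to \<open>12 * n\<close>, so \<open>D\<close> has at most
      \<open>6 * n\<close> elements and at least \<open>5 * n\<close> colours avoid two sets at
      once.\<close>
    define D where "D = (G \<inter> G') \<union> (G'' \<inter> (G \<union> G'))"
    have "card D \<le> card (G \<inter> G') + card G''"
      using card_Un_le[of "G \<inter> G'" "G'' \<inter> (G \<union> G')"] card_mono[of G'' "G'' \<inter> (G \<union> G')"] fin
      by (simp add: D_def)
    moreover have "card D \<le> card (G \<union> G')" using fin by (intro card_mono) (auto simp: D_def)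
    ultimately have "card D \<le> 6 * n" using un[OF fin(1,2)] G G' G'' by linarith
    moreover have "X \<union> Y \<union> Z = U - D" unfolding X_def Y_def Z_def D_def by blast
    moreover have "D \<subseteq> U" using G G' by (auto simp: D_def)
    ultimately have 2: "4 * n \<le> card (X \<union> Y \<union> Z)" using compl[of D] by simp
    have fXYZ: "finite X" "finite Y" "finite Z" using U by (auto simp: X_def Y_def Z_def)
    obtain P Q R where P: "P \<subseteq> X" "card P = 2 * n" and Q: "Q \<subseteq> Y" "card Q = n"
      and R: "R \<subseteq> Z" "card R = n" and PQR: "P \<inter> Q = {}" "P \<inter> R = {}" "Q \<inter> R = {}"
      using disjoint_representatives[OF fXYZ 1 2] by metis
    define M where "M = P \<union> Q \<union> R"
    have MU: "M \<subseteq> U" using P Q R by (auto simp: M_def X_def Y_def Z_def)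
    have fM: "finite M" using MU U finite_subset by blast
    have cM: "card M \<le> 4 * n"
      using card_Un_le[of "P \<union> Q" R] card_Un_le[of P Q] P Q R unfolding M_def by linarith
    have 3: "3 * n \<le> card (U - M - H)" if "H \<subseteq> U" "card H = 4 * n" for H
    proof -
      have "card (M \<union> H) \<le> 8 * n" using card_Un_le[of M H] cM that by linarith
      moreover have "U - M - H = U - (M \<union> H)" by blast
      ultimately show ?thesis using compl[of "M \<union> H"] MU that by simp
    qed
    \<comment> \<open>The second round picks blocks that avoid a single set, among the colours
      outside \<open>M\<close>. This is where the case assumption enters: only the colours common to
      all three sets, at most \<open>3 * n\<close> of them, are useless here.\<close>
    have "(U - M - G) \<union> (U - M - G') \<union> (U - M - G'') = U - (M \<union> T)" by (auto simp: T_def)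
    moreover have "card (M \<union> T) \<le> 7 * n" using card_Un_le[of M T] cM True by linarith
    moreover have "M \<union> T \<subseteq> U" using MU G by (auto simp: T_def)
    ultimately have 4: "4 * n \<le> card ((U - M - G) \<union> (U - M - G') \<union> (U - M - G''))"
      using compl[of "M \<union> T"] by simp
    have fU: "finite (U - M - H)" for H using U by simp
    obtain S R' E where S: "S \<subseteq> U - M - G" "card S = 2 * n" and R': "R' \<subseteq> U - M - G'" "card R' = n"
      and E: "E \<subseteq> U - M - G''" "card E = n" and SRE: "S \<inter> R' = {}" "S \<inter> E = {}" "R' \<inter> E = {}"
      using disjoint_representatives[OF fU fU fU 3[OF G(2,3)] 3[OF G'(2,3)] 3[OF G''(2,3)] 4] by metis
    obtain p1 p2 where p: "p1 \<subseteq> P" "p2 \<subseteq> P" "p1 \<inter> p2 = {}" "card p1 = n" "card p2 = n"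
      using halve[OF P(2)] by metis
    obtain s1 s2 where s: "s1 \<subseteq> S" "s2 \<subseteq> S" "s1 \<inter> s2 = {}" "card s1 = n" "card s2 = n"
      using halve[OF S(2)] by metis
    let ?xs = "[p1, p2, Q, R, E, R', s1, s2]"
    have MM: "P \<inter> H = {}" "Q \<inter> H = {}" "R \<inter> H = {}" if "H \<subseteq> U - M - H'" for H H'
      using that by (auto simp: M_def)
    have "sorted_wrt (\<lambda>A B. A \<inter> B = {}) [P, Q, R, E, R', S]"
      using PQR SRE MM[OF S(1)] MM[OF R'(1)] MM[OF E(1)] by (simp add: Int_commute)
    then have "sorted_wrt (\<lambda>A B. A \<inter> B = {}) [p1, p2, Q, R, E, R', S]"
      using disjoint_list_split[of "[]" P "[Q, R, E, R', S]" p1 p2] p by simp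
    then have srt: "sorted_wrt (\<lambda>A B. A \<inter> B = {}) ?xs"
      using disjoint_list_split[of "[p1, p2, Q, R, E, R']" S "[]" s1 s2] s by simp
    have PU: "P \<subseteq> U" using P(1) by (auto simp: X_def)
    have SU: "S \<subseteq> U" using S(1) by auto
    have "Q \<subseteq> U" using Q(1) by (auto simp: Y_def)
    moreover have "R \<subseteq> U" using R(1) by (auto simp: Z_def)
    moreover have "E \<subseteq> U" "R' \<subseteq> U" using E(1) R'(1) by auto
    moreover have "p1 \<subseteq> U" "p2 \<subseteq> U" using p(1,2) PU by auto
    moreover have "s1 \<subseteq> U" "s2 \<subseteq> U" using s(1,2) SU by auto
    ultimately have cd: "\<forall>A\<in>set ?xs. A \<subseteq> {..<11 * n} \<and> card A = n"
      unfolding U_def using p s Q R R' E by simp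
    obtain K where K: "color_blocks n 11 K" "\<And>i. i < length ?xs \<Longrightarrow> K i = ?xs ! i"
      by (rule color_blocks_extend[OF srt cd[rule_format]]) auto
    have Ki: "K 0 = p1" "K 1 = p2" "K 2 = Q" "K 3 = R" "K 4 = E" "K 5 = R'" "K 6 = s1" "K 7 = s2"
      using K(2) by (simp_all add: nth_Cons')
    have "p1 \<subseteq> U - G'" "p2 \<subseteq> U - G'" "p1 \<subseteq> U - G''" "p2 \<subseteq> U - G''" "Q \<subseteq> U - G" "Q \<subseteq> U - G''"
      "R \<subseteq> U - G" "R \<subseteq> U - G'" "E \<subseteq> U - G''" "R' \<subseteq> U - G'" "s1 \<subseteq> U - G" "s2 \<subseteq> U - G"
      using p s P Q R S R' E unfolding X_def Y_def Z_def by blast+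
    then have "(\<forall>i\<in>{2,3,6,7}. K i \<inter> F = {}) \<and> (\<forall>i\<in>{0,1,3,5}. K i \<inter> F' = {}) \<and> (\<forall>i\<in>{0,1,2,4}. K i \<inter> F'' = {})"
      using avoid avoid' avoid'' by (simp add: Ki del: One_nat_def)
    then show ?thesis using that[OF K(1)] by blast
  next
    case False
    let ?H = "G \<union> G' \<union> G''"
    \<comment> \<open>\<open>T\<close> is contained in both intersections, so inclusion-exclusion
      takes at least \<open>6 * n\<close> off the total of \<open>12 * n\<close>.\<close>
    have TG: "card T \<le> card (G \<inter> G')" "card T \<le> card ((G \<union> G') \<inter> G'')"
      using fin by (auto intro!: card_mono simp: T_def)
    then have "card ?H \<le> 6 * n"
      using un[OF fin(1,2)] un[of "G \<union> G'" G''] fin False G G' G'' by simp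
    then have "5 * n \<le> card (U - ?H)" using compl[of ?H] G G' G'' by simp
    then obtain D where D: "D \<subseteq> U - ?H" "card D = 5 * n" using obtain_subset_with_card_n by metis
    have fD: "finite D" using D U finite_subset by blast
    obtain D1 where D1: "D1 \<subseteq> D" "card D1 = n" using D obtain_subset_with_card_n[of n D] by auto
    then have "card (D - D1) = 2 * (2 * n)"
      using D fD card_Diff_subset[of D1 D] finite_subset[of D1 D] by simp
    then obtain A B where AB: "A \<subseteq> D - D1" "B \<subseteq> D - D1" "A \<inter> B = {}" "card A = 2 * n" "card B = 2 * n"
      using halve by metis
    obtain a1 a2 where a: "a1 \<subseteq> A" "a2 \<subseteq> A" "a1 \<inter> a2 = {}" "card a1 = n" "card a2 = n"
      using halve[OF AB(4)] by metis
    obtain b1 b2 where b: "b1 \<subseteq> B" "b2 \<subseteq> B" "b1 \<inter> b2 = {}" "card b1 = n" "card b2 = n"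
      using halve[OF AB(5)] by metis
    have "card (D \<union> G) \<le> 9 * n" using card_Un_le[of D G] D G by linarith
    moreover have "D \<union> G \<subseteq> U" using D G by blast
    ultimately have "n \<le> card (U - (D \<union> G))" using compl[of "D \<union> G"] by simp
    then obtain E where E: "E \<subseteq> U - (D \<union> G)" "card E = n" using obtain_subset_with_card_n by metis
    let ?xs = "[a1, a2, b1, b2, D1, E]"
    have "A \<inter> D1 = {}" "A \<inter> E = {}" "B \<inter> D1 = {}" "B \<inter> E = {}" "D1 \<inter> E = {}"
      using AB D1 E by blast+
    then have "sorted_wrt (\<lambda>A B. A \<inter> B = {}) [A, B, D1, E]" using AB(3) by simp
    then have "sorted_wrt (\<lambda>A B. A \<inter> B = {}) [a1, a2, B, D1, E]"
      using disjoint_list_split[of "[]" A "[B, D1, E]" a1 a2] a by simp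
    then have srt: "sorted_wrt (\<lambda>A B. A \<inter> B = {}) ?xs"
      using disjoint_list_split[of "[a1, a2]" B "[D1, E]" b1 b2] b by simp
    have "a1 \<subseteq> U" "a2 \<subseteq> U" "b1 \<subseteq> U" "b2 \<subseteq> U" "D1 \<subseteq> U" "E \<subseteq> U"
      using AB a b D D1 E by blast+
    then have cd: "\<forall>A\<in>set ?xs. A \<subseteq> {..<11 * n} \<and> card A = n"
      unfolding U_def using a b D1 E by simp
    obtain K where K: "color_blocks n 11 K" "\<And>i. i < length ?xs \<Longrightarrow> K i = ?xs ! i"
      by (rule color_blocks_extend[OF srt cd[rule_format]]) auto
    have Ki: "K 0 = a1" "K 1 = a2" "K 2 = b1" "K 3 = b2" "K 4 = D1" "K 5 = E"
      using K(2) by (simp_all add: nth_Cons')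
    have sub: "a1 \<subseteq> U - ?H" "a2 \<subseteq> U - ?H" "b1 \<subseteq> U - ?H" "b2 \<subseteq> U - ?H" "D1 \<subseteq> U - ?H"
      using AB a b D D1 by blast+
    have all: "x \<inter> F = {}" "x \<inter> F' = {}" "x \<inter> F'' = {}" if "x \<subseteq> U - ?H" for x
      using avoid[of x] avoid'[of x] avoid''[of x] that by blast+
    have "E \<inter> F = {}" by (rule avoid) (use E in blast)
    then have "(\<forall>i\<in>{0,1,3,5}. K i \<inter> F = {}) \<and> (\<forall>i\<in>{0,1,2,4}. K i \<inter> F' = {}) \<and> (\<forall>i\<in>{0,1,2,3}. K i \<inter> F'' = {})"
      using all[OF sub(1)] all[OF sub(2)] all[OF sub(3)] all[OF sub(4)] all[OF sub(5)] by (simp add: Ki del: One_nat_def)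
    then show ?thesis using that[OF K(1)] by blast
  qed
qed

section \<open>Critical subcubic graphs\<close>

lemma fractional_chromatic_number_le:
  assumes "fold_coloring G a b c" "0 < a" "0 < b"
  shows "fractional_chromatic_number G \<le> real a / real b"
  unfolding fractional_chromatic_number_def
proof (rule cInf_lower)
  show "bdd_below {real a / real b |a b. 0 < a \<and> 0 < b \<and> (\<exists>c. fold_coloring G a b c)}"
    by (rule bdd_belowI[of _ 0]) auto
qed (use assms in auto)

lemma fractional_chromatic_number_less:
  assumes G: "pair_graph G" and t: "fractional_chromatic_number G < t"
  obtains a b c where "0 < a" "0 < b" "fold_coloring G a b c" "real a / real b < t"
proof -
  interpret pair_graph G by (rule G)
  obtain h where h: "bij_betw h (pverts G) {0..<card (pverts G)}"
    using ex_bij_betw_finite_nat[OF pair_finite_verts] by blast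
  have "h v < card (pverts G)" if "v \<in> pverts G" for v
    using bij_betwE[OF h] that by auto
  moreover have "h u \<noteq> h v" if "u \<in> pverts G" "v \<in> pverts G" "(u, v) \<in> parcs G" for u v
    using h that pair_no_loops by (fastforce simp: bij_betw_def inj_on_def)
  \<comment> \<open>Pairwise different colours show that the infimum runs over a non-empty set;
    \<open>Suc\<close> keeps the palette positive even for a graph without vertices.\<close>
  ultimately have "fold_coloring G (Suc (card (pverts G))) 1 (\<lambda>v. {h v})"
    by (fastforce simp: fold_coloring_def)
  then have "{real a / real b |a b. 0 < a \<and> 0 < b \<and> (\<exists>c. fold_coloring G a b c)} \<noteq> {}"
    by blast
  from cInf_lessD[OF this t[unfolded fractional_chromatic_number_def]] show ?thesis
    using that by auto
qed

text \<open>Every colour becomes a run of \<open>m\<close> consecutive colours; the palette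
  \<open>a'\<close> may contain further colours that no vertex uses.\<close>

lemma fold_coloring_scale:
  assumes "fold_coloring G a b c" "0 < m" "m * a \<le> a'"
  shows "fold_coloring G a' (m * b) (\<lambda>v. {q. q div m \<in> c v})"
proof -
  have card: "card {q. q div m \<in> A} = m * card A" for A :: "nat set"
  proof -
    have dm: "(m * q + r) div m = q" "(m * q + r) mod m = r" if "r < m" for q r
      using that by simp_all
    have "bij_betw (\<lambda>(q, r). m * q + r) (A \<times> {..<m}) {q. q div m \<in> A}"
      by (rule bij_betw_byWitness[where f' = "\<lambda>q. (q div m, q mod m)"])
        (auto simp: dm \<open>0 < m\<close> simp del: div_mult_self1 div_mult_self2)
    from bij_betw_same_card[OF this] show ?thesis by (simp add: card_cartesian_product mult.commute)
  qed
  have "q < a'" if "q div m < a" for q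
  proof -
    have "q < m * a" using that assms by (simp add: div_less_iff_less_mult mult.commute)
    then show ?thesis using assms by simp
  qed
  then show ?thesis
    using assms card unfolding fold_coloring_def by (fastforce simp: subset_iff disjoint_iff)
qed

section \<open>Colourings supplied by criticality and their extension\<close>

locale critical_subcubic =
  fixes G :: "'a pair_pre_digraph"
  assumes graph: "pair_graph G" and crit: "fractionally_critical G" and tri: "triangle_free G"
    and deg: "\<forall>v \<in> pverts G. out_degree G v \<le> 3"
    and large: "11 / 4 < fractional_chromatic_number G"
begin

sublocale pair_graph G by (rule graph)

abbreviation adj :: "'a \<Rightarrow> 'a \<Rightarrow> bool" where
  "adj u v \<equiv> (u, v) \<in> parcs G"

lemma adj_sym: "adj u v \<Longrightarrow> adj v u"
  using pair_sym_arcs by (auto simp: symmetric_def elim: symE)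

lemma adj_neq: "adj u v \<Longrightarrow> u \<noteq> v"
  using pair_no_loops by fastforce

lemma adj_verts: "adj u v \<Longrightarrow> u \<in> pverts G \<and> v \<in> pverts G"
  using in_arcsD1 in_arcsD2 by blast

lemma no_triangle: "adj u v \<Longrightarrow> adj v w \<Longrightarrow> \<not> adj u w"
  using tri adj_sym[of u w] unfolding triangle_free_def with_proj_simps by blast

lemma card_nbrs: "finite {y. adj v y} \<and> card {y. adj v y} \<le> 3"
proof (cases "v \<in> pverts G")
  case True
  have "out_arcs G v = Pair v ` {y. adj v y}"
    by (auto simp: out_arcs_def image_iff)
  then have "out_degree G v = card {y. adj v y}"
    unfolding out_degree_def by (simp add: card_image inj_on_def)
  moreover have "{y. adj v y} \<subseteq> pverts G" using adj_verts by blast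
  ultimately show ?thesis using True deg finite_subset pair_finite_verts by metis
next
  case False
  then have "{y. adj v y} = {}" using adj_verts by blast
  then show ?thesis by simp
qed

lemma nbrs_eq:
  assumes "adj v p" "adj v q" "adj v r" "distinct [p, q, r]"
  shows "adj v y \<longleftrightarrow> y = p \<or> y = q \<or> y = r" "adj y v \<longleftrightarrow> y = p \<or> y = q \<or> y = r"
proof -
  have "{p, q, r} \<subseteq> {y. adj v y}" "card {p, q, r} = 3" using assms by auto
  then have "{p, q, r} = {y. adj v y}"
    using card_nbrs[of v] by (intro card_seteq) auto
  then show *: "adj v y \<longleftrightarrow> y = p \<or> y = q \<or> y = r" by blast
  show "adj y v \<longleftrightarrow> y = p \<or> y = q \<or> y = r" using * adj_sym by blast
qed

text \<open>A colouring of \<open>H\<close> with ratio below the value of \<open>G\<close> is scaled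
  by four, and its palette is padded to at least eleven times the old set size. The new ratio is the
  maximum of the old one and 11/4, still below the value of \<open>G\<close>, so \<open>G\<close>
  itself has no colouring with these parameters. Every later contradiction comes from extending the
  colouring of \<open>H\<close> to \<open>G\<close>.\<close>

lemma proper_subgraph_coloring:
  assumes H: "pair_graph H" "subgraph H G" "H \<noteq> G"
  obtains a n c where "0 < n" "11 * n \<le> a" "fold_coloring H a (4 * n) c" "\<And>c'. \<not> fold_coloring G a (4 * n) c'"
proof -
  have "fractional_chromatic_number H < fractional_chromatic_number G"
    using crit H unfolding fractionally_critical_def by blast
  then obtain a b c where abc: "0 < a" "0 < b" "fold_coloring H a b c"
    "real a / real b < fractional_chromatic_number G"
    using fractional_chromatic_number_less[OF H(1)] by metis
  let ?a = "max (4 * a) (11 * b)"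
  have "fold_coloring H ?a (4 * b) (\<lambda>v. {q. q div 4 \<in> c v})"
    by (rule fold_coloring_scale[OF abc(3)]) auto
  moreover have False if "fold_coloring G ?a (4 * b) c'" for c'
  proof -
    have "fractional_chromatic_number G \<le> real ?a / real (4 * b)"
      using fractional_chromatic_number_le[OF that] abc by simp
    moreover have "real ?a / real (4 * b) = max (real a / real b) (11 / 4)"
      using abc by (simp add: max_def field_simps)
    moreover have "max (real a / real b) (11 / 4) < fractional_chromatic_number G"
      using abc(4) large by simp
    ultimately show False by linarith
  qed
  ultimately show ?thesis using that[of b ?a] abc by auto
qed

lemma deleted_vertices_coloring:
  assumes S: "S \<subseteq> pverts G" "S \<noteq> {}"
  obtains a n c where "0 < n" "11 * n \<le> a"
    "\<And>v. v \<in> pverts G - S \<Longrightarrow> c v \<subseteq> {..<a} \<and> card (c v) = 4 * n"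
    "\<And>u v. u \<in> pverts G - S \<Longrightarrow> v \<in> pverts G - S \<Longrightarrow> adj u v \<Longrightarrow> c u \<inter> c v = {}"
    "\<And>c'. \<not> fold_coloring G a (4 * n) c'"
proof -
  define H where "H = \<lparr>pverts = pverts G - S, parcs = {e \<in> parcs G. fst e \<notin> S \<and> snd e \<notin> S}\<rparr>"
  have H: "pverts H = pverts G - S" "parcs H = {e \<in> parcs G. fst e \<notin> S \<and> snd e \<notin> S}"
    by (simp_all add: H_def)
  have pH: "pair_graph H"
  proof
    show "finite (parcs H)" using pair_finite_arcs by (simp add: H)
    show "symmetric H" using adj_sym by (auto simp: H symmetric_def intro!: symI)
  qed (use H pair_finite_verts pair_no_loops arc_fst_in_verts arc_snd_in_verts in auto)
  have wfH: "wf_digraph H" using pH pair_graph.axioms by unfold_locales (auto simp: H in_arcsD1 in_arcsD2)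
  have "subgraph H G"
    using wfH wf_digraph_axioms by (auto simp: subgraph_def compatible_def H)
  moreover have "H \<noteq> G" using S H(1) by auto
  ultimately obtain a n c where c: "0 < n" "11 * n \<le> a" "fold_coloring H a (4 * n) c"
    "\<And>c'. \<not> fold_coloring G a (4 * n) c'"
    using proper_subgraph_coloring[OF pH] by metis
  show ?thesis
    by (rule that[of n a c]) (use c in \<open>auto simp: fold_coloring_def H\<close>)
qed

text \<open>After deletion of the edge the two sides do not interact, so the colours on
  \<open>S\<close> may be permuted at will. Since \<open>8 * n \<le> a\<close>, some permutation of
  the palette moves \<open>c x\<close> off \<open>c z\<close>, and the edge can be restored.\<close>

lemma no_bridge:
  assumes S: "x \<in> S" "z \<notin> S" "adj x z"
    and bridge: "\<And>u v. u \<in> S \<Longrightarrow> v \<notin> S \<Longrightarrow> adj u v \<Longrightarrow> u = x \<and> v = z"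
  shows False
proof -
  define H where "H = \<lparr>pverts = pverts G, parcs = parcs G - {(x, z), (z, x)}\<rparr>"
  have H: "pverts H = pverts G" "parcs H = parcs G - {(x, z), (z, x)}"
    by (simp_all add: H_def)
  have pH: "pair_graph H"
  proof
    show "finite (parcs H)" using pair_finite_arcs by (simp add: H)
    show "symmetric H" using adj_sym by (auto simp: H symmetric_def intro!: symI)
  qed (use H pair_finite_verts pair_no_loops arc_fst_in_verts arc_snd_in_verts in auto)
  have wfH: "wf_digraph H" using pH pair_graph.axioms by unfold_locales (auto simp: H in_arcsD1 in_arcsD2)
  have "subgraph H G"
    using wfH wf_digraph_axioms by (auto simp: subgraph_def compatible_def H)
  moreover have "H \<noteq> G" using S H(2) by auto
  ultimately obtain a n c where c: "0 < n" "11 * n \<le> a" "fold_coloring H a (4 * n) c"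
    "\<And>c'. \<not> fold_coloring G a (4 * n) c'"
    using proper_subgraph_coloring[OF pH] by metis
  have cV: "c v \<subseteq> {..<a}" "card (c v) = 4 * n" if "v \<in> pverts G" for v
    using c(3) that by (auto simp: fold_coloring_def H)
  have cd: "c u \<inter> c v = {}" if "adj u v" "(u, v) \<noteq> (x, z)" "(u, v) \<noteq> (z, x)" for u v
    using c(3) that adj_verts[OF that(1)] by (auto simp: fold_coloring_def H)
  have xz: "x \<in> pverts G" "z \<in> pverts G" using adj_verts S by blast+
  have fin: "finite (c v)" if "v \<in> pverts G" for v using cV[OF that] finite_subset by blast
  have "card ({..<a} - c z) = a - 4 * n"
    using cV[OF xz(2)] fin[OF xz(2)] by (simp add: card_Diff_subset)
  then have "4 * n \<le> card ({..<a} - c z)" using c(2) by simp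
  then obtain T where T: "T \<subseteq> {..<a} - c z" "card T = 4 * n"
    using obtain_subset_with_card_n by metis
  have finT: "finite T" using T finite_subset by blast
  obtain g where g: "bij_betw g (c x) T"
    using finite_same_card_bij[OF fin[OF xz(1)] finT] cV[OF xz(1)] T by auto
  have "card ({..<a} - c x) = card ({..<a} - T)"
    using cV[OF xz(1)] fin[OF xz(1)] finT T by (subst (1 2) card_Diff_subset) auto
  then obtain h where h: "bij_betw h ({..<a} - c x) ({..<a} - T)"
    using finite_same_card_bij[of "{..<a} - c x" "{..<a} - T"] by auto
  define p where "p q = (if q \<in> c x then g q else h q)" for q
  have "bij_betw p (c x \<union> ({..<a} - c x)) (T \<union> ({..<a} - T))"
  proof (rule bij_betw_combine)
    show "bij_betw p (c x) T" using g by (rule bij_betw_cong[THEN iffD1, rotated]) (simp add: p_def)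
    show "bij_betw p ({..<a} - c x) ({..<a} - T)"
      using h by (rule bij_betw_cong[THEN iffD1, rotated]) (simp add: p_def)
  qed blast
  moreover have "c x \<union> ({..<a} - c x) = {..<a}" "T \<union> ({..<a} - T) = {..<a}" using cV[OF xz(1)] T by auto
  ultimately have p: "inj_on p {..<a}" "p ` {..<a} = {..<a}" by (auto simp: bij_betw_def)
  have px: "p ` c x = T" using g by (auto simp: p_def bij_betw_def)
  have pd: "p ` c u \<inter> p ` c v = {}" if "u \<in> pverts G" "v \<in> pverts G" "c u \<inter> c v = {}" for u v
    using inj_on_image_Int[OF p(1) cV(1)[OF that(1)] cV(1)[OF that(2)]] that(3) by simp
  have Tz: "T \<inter> c z = {}" using T by blast
  define c' where "c' v = (if v \<in> S then p ` c v else c v)" for v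
  have "fold_coloring G a (4 * n) c'"
    unfolding fold_coloring_def
  proof (intro conjI ballI impI)
    fix v assume v: "v \<in> pverts G"
    show "c' v \<subseteq> {..<a}" using cV[OF v] p by (auto simp: c'_def)
    show "card (c' v) = 4 * n"
      using cV[OF v] card_image[OF inj_on_subset[OF p(1)]] by (simp add: c'_def)
  next
    fix u v assume uv: "u \<in> pverts G" "v \<in> pverts G" "u \<rightarrow>\<^bsub>with_proj G\<^esub> v"
    then have a: "adj u v" by simp
    consider "u \<in> S" "v \<in> S" | "u \<in> S" "v \<notin> S" | "u \<notin> S" "v \<in> S" | "u \<notin> S" "v \<notin> S" by blast
    then show "c' u \<inter> c' v = {}"
    proof cases
      case 1
      then have "c u \<inter> c v = {}" using cd[OF a] S by auto
      then show ?thesis using 1 pd uv by (simp add: c'_def)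
    next
      case 2
      then have "u = x" "v = z" using bridge a by blast+
      then show ?thesis using 2 px Tz by (simp add: c'_def)
    next
      case 3
      then have "v = x" "u = z" using bridge adj_sym[OF a] by blast+
      then show ?thesis using 3 px Tz by (simp add: c'_def Int_commute)
    next
      case 4
      then show ?thesis using cd[OF a] S by (auto simp: c'_def)
    qed
  qed
  then show False using c(4) by blast
qed

text \<open>Letting the vertices of \<open>S\<close> take unions of four out of eleven blocks turns
  the extension into a finite table \<open>J\<close>; only the edges leaving \<open>S\<close> refer
  to the colours inside the blocks.\<close>

lemma block_coloring:
  assumes K: "color_blocks n 11 K" "11 * n \<le> a"
    and c: "\<And>v. v \<in> pverts G - S \<Longrightarrow> c v \<subseteq> {..<a} \<and> card (c v) = 4 * n"
      "\<And>u v. u \<in> pverts G - S \<Longrightarrow> v \<in> pverts G - S \<Longrightarrow> adj u v \<Longrightarrow> c u \<inter> c v = {}"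
    and J: "\<And>v. v \<in> S \<Longrightarrow> J v \<subseteq> {..<11} \<and> card (J v) = 4"
      "\<And>u v. u \<in> S \<Longrightarrow> v \<in> S \<Longrightarrow> adj u v \<Longrightarrow> J u \<inter> J v = {}"
      "\<And>u v i. u \<in> S \<Longrightarrow> v \<in> pverts G - S \<Longrightarrow> adj u v \<Longrightarrow> i \<in> J u \<Longrightarrow> K i \<inter> c v = {}"
  shows "\<exists>c'. fold_coloring G a (4 * n) c'"
proof
  have Ki: "K i \<subseteq> {..<a} \<and> card (K i) = n \<and> finite (K i)" if "i < 11" for i
  proof -
    have "K i \<subseteq> {..<11 * n}" "card (K i) = n" using K that by (auto simp: color_blocks_def)
    moreover from this have "finite (K i)" using finite_subset by blast
    ultimately show ?thesis using K(2) by auto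
  qed
  have Kd: "K i \<inter> K j = {}" if "i < 11" "j < 11" "i \<noteq> j" for i j
    using K that by (auto simp: color_blocks_def)
  define c' where "c' v = (if v \<in> S then \<Union>i\<in>J v. K i else c v)" for v
  show "fold_coloring G a (4 * n) c'"
    unfolding fold_coloring_def
  proof (intro conjI ballI impI)
    fix v assume v: "v \<in> pverts G"
    show "c' v \<subseteq> {..<a}"
    proof (cases "v \<in> S")
      case True
      then have "K i \<subseteq> {..<a}" if "i \<in> J v" for i using J(1)[OF True] Ki[of i] that by blast
      then show ?thesis using True by (simp add: c'_def UN_subset_iff)
    qed (use c(1)[of v] v in \<open>simp add: c'_def\<close>)
    show "card (c' v) = 4 * n"
    proof (cases "v \<in> S")
      case True
      then have Jv: "J v \<subseteq> {..<11}" "card (J v) = 4" using J by auto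
      have "card (\<Union>i\<in>J v. K i) = (\<Sum>i\<in>J v. card (K i))"
      proof (rule card_UN_disjoint)
        show "finite (J v)" using Jv finite_subset by blast
        show "\<forall>i\<in>J v. finite (K i)" using Jv Ki by blast
        show "\<forall>i\<in>J v. \<forall>j\<in>J v. i \<noteq> j \<longrightarrow> K i \<inter> K j = {}" using Jv Kd by blast
      qed
      also have "\<dots> = (\<Sum>i\<in>J v. n)" by (rule sum.cong) (use Jv Ki in auto)
      finally show ?thesis using Jv True by (simp add: c'_def)
    qed (use c v in \<open>simp add: c'_def\<close>)
  next
    fix u v assume uv: "u \<in> pverts G" "v \<in> pverts G" "u \<rightarrow>\<^bsub>with_proj G\<^esub> v"
    then have a: "adj u v" by simp
    consider "u \<in> S" "v \<in> S" | "u \<in> S" "v \<notin> S" | "u \<notin> S" "v \<in> S" | "u \<notin> S" "v \<notin> S" by blast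
    then show "c' u \<inter> c' v = {}"
    proof cases
      case 1
      have "K i \<inter> K j = {}" if "i \<in> J u" "j \<in> J v" for i j
      proof -
        have "i \<noteq> j" using J(2)[OF 1 a] that by blast
        then show ?thesis using J(1)[OF 1(1)] J(1)[OF 1(2)] Kd[of i j] that by blast
      qed
      then show ?thesis using 1 by (auto simp: c'_def)
    next
      case 2
      then show ?thesis using J(3)[of u v] uv a by (auto simp: c'_def)
    next
      case 3
      then show ?thesis using J(3)[of v u] uv adj_sym[OF a] by (auto simp: c'_def)
    next
      case 4
      then show ?thesis using c(2)[of u v] uv a by (simp add: c'_def)
    qed
  qed
qed

definition outside_colors :: "('a \<Rightarrow> nat set) \<Rightarrow> 'a set \<Rightarrow> 'a \<Rightarrow> nat set" where
  "outside_colors c S u = (\<Union>v \<in> {v \<in> pverts G - S. adj u v}. c v)"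

text \<open>Two of the at most three neighbours of \<open>u\<close> lie in \<open>S\<close>, so all
  colours seen outside come from a single vertex.\<close>

lemma card_outside_colors:
  assumes "adj u p" "adj u q" "p \<noteq> q" "p \<in> S" "q \<in> S"
    and c: "\<And>v. v \<in> pverts G - S \<Longrightarrow> c v \<subseteq> {..<a} \<and> card (c v) = k"
  shows "card (outside_colors c S u \<inter> T) \<le> k"
proof -
  have "card ({y. adj u y} - {p, q}) \<le> 1"
    using card_nbrs[of u] assms by (subst card_Diff_subset) auto
  moreover have "finite ({y. adj u y} - {p, q})" using card_nbrs[of u] by blast
  ultimately obtain z where z: "{y. adj u y} - {p, q} \<subseteq> {z}"
    by (metis card_le_Suc0_iff_eq One_nat_def subsetI singleton_iff)
  show ?thesis
  proof (cases "z \<in> pverts G - S")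
    case True
    have "outside_colors c S u \<inter> T \<subseteq> c z" using z assms(4,5) by (auto simp: outside_colors_def)
    moreover have "finite (c z)" using c[OF True] finite_subset by blast
    ultimately show ?thesis using c[OF True] card_mono by metis
  next
    case False
    then have "outside_colors c S u = {}" using z assms(4,5) by (auto simp: outside_colors_def)
    then show ?thesis by simp
  qed
qed

end

section \<open>Five-cycles at distance two from a vertex\<close>

context critical_subcubic
begin

text \<open>
  The tables of blocks in the next two proofs come from an integer program: every vertex of the
  deleted part gets four of eleven blocks, and the vertices with a neighbour outside may only use the
  blocks that avoid the colours seen there.
\<close>

lemma no_five_cycle_abab:
  assumes cyc: "adj w0 w1" "adj w1 w2" "adj w2 w3" "adj w3 w4" "adj w4 w0"
    and att: "adj w1 a" "adj w2 b" "adj w3 a" "adj w4 b" "adj a u" "adj b u"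
    and dist: "distinct [w0, w1, w2, w3, w4, a, b, u]" and u: "\<not> adj u w0"
  shows False
proof -
  define S where "S = {w0, w1, w2, w3, w4, a, b, u}"
  note adjs = cyc att cyc[THEN adj_sym] att[THEN adj_sym]
  have dist': "distinct [u, b, a, w4, w3, w2, w1, w0]" using dist by auto
  \<comment> \<open>Three known neighbours use up the degree bound, so the neighbourhoods of these
    six vertices are completely known. Only \<open>w0\<close> and \<open>u\<close> may still have a
    neighbour outside \<open>S\<close>.\<close>
  have full: "adj w1 y \<longleftrightarrow> y = w0 \<or> y = w2 \<or> y = a" "adj w2 y \<longleftrightarrow> y = w1 \<or> y = w3 \<or> y = b"
    "adj w3 y \<longleftrightarrow> y = w2 \<or> y = w4 \<or> y = a" "adj w4 y \<longleftrightarrow> y = w3 \<or> y = w0 \<or> y = b"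
    "adj a y \<longleftrightarrow> y = w1 \<or> y = w3 \<or> y = u" "adj b y \<longleftrightarrow> y = w2 \<or> y = w4 \<or> y = u" for y
    by (rule nbrs_eq; use adjs dist dist' in simp)+
  have full': "adj y w1 \<longleftrightarrow> y = w0 \<or> y = w2 \<or> y = a" "adj y w2 \<longleftrightarrow> y = w1 \<or> y = w3 \<or> y = b"
    "adj y w3 \<longleftrightarrow> y = w2 \<or> y = w4 \<or> y = a" "adj y w4 \<longleftrightarrow> y = w3 \<or> y = w0 \<or> y = b"
    "adj y a \<longleftrightarrow> y = w1 \<or> y = w3 \<or> y = u" "adj y b \<longleftrightarrow> y = w2 \<or> y = w4 \<or> y = u" for y
    by (rule nbrs_eq; use adjs dist dist' in simp)+
  have irr: "\<not> adj y y" for y using adj_neq by blast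
  have u': "\<not> adj w0 u" using u adj_sym by blast
  have "S \<subseteq> pverts G" "S \<noteq> {}" using adjs adj_verts by (auto simp: S_def)
  then obtain n k c where nk: "0 < n" "11 * n \<le> k"
    and c: "\<And>v. v \<in> pverts G - S \<Longrightarrow> c v \<subseteq> {..<k} \<and> card (c v) = 4 * n"
      "\<And>u v. u \<in> pverts G - S \<Longrightarrow> v \<in> pverts G - S \<Longrightarrow> adj u v \<Longrightarrow> c u \<inter> c v = {}"
    and no: "\<And>c'. \<not> fold_coloring G k (4 * n) c'"
    by (rule deleted_vertices_coloring) blast
  have "card (outside_colors c S w0 \<inter> {..<11 * n}) \<le> 4 * n"
    by (rule card_outside_colors[of w0 w1 w4, OF _ _ _ _ _ c(1)]) (use adjs dist in \<open>auto simp: S_def\<close>)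
  moreover have "card (outside_colors c S u \<inter> {..<11 * n}) \<le> 4 * n"
    by (rule card_outside_colors[of u a b, OF _ _ _ _ _ c(1)]) (use adjs dist in \<open>auto simp: S_def\<close>)
  ultimately obtain K where K: "color_blocks n 11 K"
    "\<And>i. i \<in> {0,1,2,3} \<Longrightarrow> K i \<inter> outside_colors c S w0 = {}"
    "\<And>i. i \<in> {0,1,2,4} \<Longrightarrow> K i \<inter> outside_colors c S u = {}"
    by (rule blocks_two_constraints) blast
  define J :: "'a \<Rightarrow> nat set" where "J v = the (map_of [(w0, {0,1,2,3}), (w1, {4,5,6,7}), (w2, {0,8,9,10}),
    (w3, {1,2,6,7}), (w4, {4,8,9,10}), (a, {3,8,9,10}), (b, {3,5,6,7}), (u, {0,1,2,4})] v)" for v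
  have J: "J w0 = {0,1,2,3}" "J w1 = {4,5,6,7}" "J w2 = {0,8,9,10}" "J w3 = {1,2,6,7}"
    "J w4 = {4,8,9,10}" "J a = {3,8,9,10}" "J b = {3,5,6,7}" "J u = {0,1,2,4}"
    using dist by (auto simp: J_def)
  have "\<exists>c'. fold_coloring G k (4 * n) c'"
  proof (rule block_coloring[OF K(1) nk(2) c])
    fix v assume "v \<in> S"
    then show "J v \<subseteq> {..<11} \<and> card (J v) = 4"
      unfolding S_def by (elim insertE emptyE) (simp_all add: J)
  next
    fix x y assume "x \<in> S" "y \<in> S" "adj x y"
    then show "J x \<inter> J y = {}"
      using dist dist' u u' unfolding S_def by (elim insertE emptyE) (simp_all add: J full full' irr)
  next
    fix x y i assume xy: "x \<in> S" "y \<in> pverts G - S" "adj x y" and i: "i \<in> J x"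
    then have "x = w0 \<or> x = u" unfolding S_def by (elim insertE emptyE) (simp_all add: full)
    moreover have "K i \<inter> outside_colors c S x = {}"
      using calculation K(2)[of i] K(3)[of i] i J(1,8) by metis
    ultimately show "K i \<inter> c y = {}" using xy by (auto simp: outside_colors_def)
  qed
  then show False using no by blast
qed

text \<open>Along \<open>w1\<close>, ..., \<open>w4\<close> the attachments read a, b, a, c or a, b,
  c, a; the pair \<open>(x, x')\<close> treats both orders at once, \<open>x\<close> being the
  second vertex attached to \<open>a\<close>. The degrees of \<open>u\<close>, \<open>a\<close> and
  \<open>w1\<close>, ..., \<open>w4\<close> are used up, so only \<open>w0\<close>, \<open>b\<close>
  and \<open>c\<close> can see the outside. These three are pairwise non-adjacent, by assumption and
  because an edge between \<open>b\<close> and \<open>c\<close> would form a triangle with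
  \<open>u\<close>.\<close>

lemma no_five_cycle_three_attachments:
  assumes cyc: "adj w0 w1" "adj w1 w2" "adj w2 w3" "adj w3 w4" "adj w4 w0"
    and att: "adj w1 a" "adj w2 b" "adj x a" "adj x' c" "adj a u" "adj b u" "adj c u"
    and x: "(x, x') = (w3, w4) \<or> (x, x') = (w4, w3)"
    and dist: "distinct [w0, w1, w2, w3, w4, a, b, c, u]"
    and w0: "\<not> adj w0 b" "\<not> adj w0 c"
  shows False
proof -
  define S where "S = {w0, w1, w2, w3, w4, a, b, c, u}"
  define y3 where "y3 = (if x = w3 then a else c)"
  define y4 where "y4 = (if x = w3 then c else a)"
  have att3: "adj w3 y3" "adj w4 y4" and dist3: "distinct [w2, w4, y3]" "distinct [w3, w0, y4]" "distinct [w1, x, u]"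
    using x att dist by (auto simp: y3_def y4_def)
  note adjs = cyc att att3 cyc[THEN adj_sym] att[THEN adj_sym] att3[THEN adj_sym]
  have dist': "distinct [u, c, b, a, w4, w3, w2, w1, w0]" using dist by auto
  have full: "adj w1 y \<longleftrightarrow> y = w0 \<or> y = w2 \<or> y = a" "adj w2 y \<longleftrightarrow> y = w1 \<or> y = w3 \<or> y = b"
    "adj w3 y \<longleftrightarrow> y = w2 \<or> y = w4 \<or> y = y3" "adj w4 y \<longleftrightarrow> y = w3 \<or> y = w0 \<or> y = y4"
    "adj a y \<longleftrightarrow> y = w1 \<or> y = x \<or> y = u" "adj u y \<longleftrightarrow> y = a \<or> y = b \<or> y = c" for y
    by (rule nbrs_eq; use adjs dist dist' dist3 in simp)+
  have full': "adj y w1 \<longleftrightarrow> y = w0 \<or> y = w2 \<or> y = a" "adj y w2 \<longleftrightarrow> y = w1 \<or> y = w3 \<or> y = b"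
    "adj y w3 \<longleftrightarrow> y = w2 \<or> y = w4 \<or> y = y3" "adj y w4 \<longleftrightarrow> y = w3 \<or> y = w0 \<or> y = y4"
    "adj y a \<longleftrightarrow> y = w1 \<or> y = x \<or> y = u" "adj y u \<longleftrightarrow> y = a \<or> y = b \<or> y = c" for y
    by (rule nbrs_eq; use adjs dist dist' dist3 in simp)+
  have non: "\<not> adj y y" "\<not> adj b c" "\<not> adj c b" "\<not> adj w0 b" "\<not> adj b w0" "\<not> adj w0 c" "\<not> adj c w0" for y
    using adj_neq no_triangle[of b u c] adjs w0 adj_sym by blast+
  have "S \<subseteq> pverts G" "S \<noteq> {}" using adjs adj_verts by (auto simp: S_def)
  then obtain n k f where nk: "0 < n" "11 * n \<le> k"
    and f: "\<And>v. v \<in> pverts G - S \<Longrightarrow> f v \<subseteq> {..<k} \<and> card (f v) = 4 * n"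
      "\<And>u v. u \<in> pverts G - S \<Longrightarrow> v \<in> pverts G - S \<Longrightarrow> adj u v \<Longrightarrow> f u \<inter> f v = {}"
    and no: "\<And>f'. \<not> fold_coloring G k (4 * n) f'"
    by (rule deleted_vertices_coloring) blast
  have xS: "x' \<in> S" "x' \<noteq> u" using x dist by (auto simp: S_def)
  have "card (outside_colors f S w0 \<inter> {..<11 * n}) \<le> 4 * n"
    by (rule card_outside_colors[of w0 w1 w4, OF _ _ _ _ _ f(1)]) (use adjs dist in \<open>auto simp: S_def\<close>)
  moreover have "card (outside_colors f S b \<inter> {..<11 * n}) \<le> 4 * n"
    by (rule card_outside_colors[of b w2 u, OF _ _ _ _ _ f(1)]) (use adjs dist in \<open>auto simp: S_def\<close>)
  moreover have "card (outside_colors f S c \<inter> {..<11 * n}) \<le> 4 * n"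
    by (rule card_outside_colors[of c x' u, OF _ _ _ _ _ f(1)]) (use adjs xS in \<open>auto simp: S_def\<close>)
  ultimately obtain K where K: "color_blocks n 11 K"
    "(\<forall>i\<in>{2,3,6,7}. K i \<inter> outside_colors f S w0 = {}) \<and> (\<forall>i\<in>{0,1,3,5}. K i \<inter> outside_colors f S b = {}) \<and>
       (\<forall>i\<in>{0,1,2,4}. K i \<inter> outside_colors f S c = {}) \<or>
     (\<forall>i\<in>{0,1,3,5}. K i \<inter> outside_colors f S w0 = {}) \<and> (\<forall>i\<in>{0,1,2,4}. K i \<inter> outside_colors f S b = {}) \<and>
       (\<forall>i\<in>{0,1,2,3}. K i \<inter> outside_colors f S c = {})"
    by (rule blocks_three_constraints) blast
  \<comment> \<open>\<open>Pp\<close>, \<open>Pq\<close>, \<open>Pr\<close>, \<open>Ps\<close>,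
    \<open>Pt\<close> are the block sets of \<open>w0\<close>, ..., \<open>w4\<close>, and the
    others belong to the vertices named by their second letter.\<close>
  have extend: False
    if P: "\<And>P. P \<in> set [Pp, Pq, Pr, Ps, Pt, Pa, Pb, Pc, Pu] \<Longrightarrow> P \<subseteq> {..<11} \<and> card P = 4"
      and E: "Pp \<inter> Pq = {}" "Pq \<inter> Pr = {}" "Pr \<inter> Ps = {}" "Ps \<inter> Pt = {}" "Pt \<inter> Pp = {}"
        "Pq \<inter> Pa = {}" "Pr \<inter> Pb = {}" "Pa \<inter> Pu = {}" "Pb \<inter> Pu = {}" "Pc \<inter> Pu = {}"
        "if x = w3 then Ps \<inter> Pa = {} \<and> Pt \<inter> Pc = {} else Pt \<inter> Pa = {} \<and> Ps \<inter> Pc = {}"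
      and out: "\<forall>i\<in>Pp. K i \<inter> outside_colors f S w0 = {}" "\<forall>i\<in>Pb. K i \<inter> outside_colors f S b = {}"
        "\<forall>i\<in>Pc. K i \<inter> outside_colors f S c = {}"
    for Pp Pq Pr Ps Pt Pa Pb Pc Pu :: "nat set"
  proof -
    define J :: "'a \<Rightarrow> nat set" where "J v = the (map_of [(w0, Pp), (w1, Pq), (w2, Pr), (w3, Ps), (w4, Pt),
      (a, Pa), (b, Pb), (c, Pc), (u, Pu)] v)" for v
    have J: "J w0 = Pp" "J w1 = Pq" "J w2 = Pr" "J w3 = Ps" "J w4 = Pt" "J a = Pa" "J b = Pb" "J c = Pc" "J u = Pu"
      using dist by (auto simp: J_def)
    have y34: "Ps \<inter> J y3 = {}" "Pt \<inter> J y4 = {}" "y3 \<in> {a, c}" "y4 \<in> {a, c}"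
      using E(11) J by (auto simp: y3_def y4_def)
    have edges: "J v \<inter> J y = {}" if vy: "adj v y" "v \<in> {w1, w2, w3, w4, a, u}" for v y
    proof -
      consider "v = w1" | "v = w2" | "v = w3" | "v = w4" | "v = a" | "v = u" using vy by blast
      then show ?thesis
      proof cases
        case 5
        then have "y = w1 \<or> y = x \<or> y = u" using vy(1) full(5) by simp
        moreover have "x = w3 \<and> y3 = a \<or> x = w4 \<and> y4 = a" using x dist by (auto simp: y3_def y4_def)
        ultimately show ?thesis using 5 E y34 by (elim disjE conjE) (simp_all add: J Int_commute)
      next
        case 1
        then show ?thesis using vy(1) full(1) E by (auto simp: J)
      next
        case 2
        then show ?thesis using vy(1) full(2) E by (auto simp: J)
      next
        case 3
        then show ?thesis using vy(1) full(3) E y34 by (auto simp: J)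
      next
        case 4
        then show ?thesis using vy(1) full(4) E y34 by (auto simp: J)
      next
        case 6
        then show ?thesis using vy(1) full(6) E by (auto simp: J)
      qed
    qed
    have "\<exists>c'. fold_coloring G k (4 * n) c'"
    proof (rule block_coloring[OF K(1) nk(2) f])
      fix v assume "v \<in> S"
      then show "J v \<subseteq> {..<11} \<and> card (J v) = 4"
        unfolding S_def by (elim insertE emptyE; hypsubst; unfold J; intro P; simp)
    next
      fix v y assume vy: "v \<in> S" "y \<in> S" "adj v y"
      show "J v \<inter> J y = {}"
      proof (cases "v \<in> {w1, w2, w3, w4, a, u} \<or> y \<in> {w1, w2, w3, w4, a, u}")
        case True
        then show ?thesis using edges[of v y] edges[of y v] vy adj_sym by (metis Int_commute)
      next
        case False
        then have "v \<in> {w0, b, c}" "y \<in> {w0, b, c}" using vy unfolding S_def by blast+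
        then show ?thesis using non vy(3) by (elim insertE emptyE) simp_all
      qed
    next
      fix v y i assume vy: "v \<in> S" "y \<in> pverts G - S" "adj v y" and i: "i \<in> J v"
      have y: "y \<noteq> w0" "y \<noteq> w1" "y \<noteq> w2" "y \<noteq> w3" "y \<noteq> w4" "y \<noteq> a" "y \<noteq> b" "y \<noteq> c" "y \<noteq> u"
        using vy(2) unfolding S_def by blast+
      moreover have "y \<noteq> x" using y x by blast
      moreover have "y \<noteq> y3" "y \<noteq> y4" using y by (simp_all add: y3_def y4_def)
      ultimately have "v \<noteq> w1" "v \<noteq> w2" "v \<noteq> w3" "v \<noteq> w4" "v \<noteq> a" "v \<noteq> u"
        using vy(3) full[of y] by metis+
      then have "v = w0 \<or> v = b \<or> v = c" using vy(1) unfolding S_def by blast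
      then have "K i \<inter> outside_colors f S v = {}" using out i J by (elim disjE) simp_all
      then show "K i \<inter> f y = {}" using vy by (auto simp: outside_colors_def)
    qed
    then show False using no by blast
  qed
  show False
  proof (cases "x = w3")
    case True
    show False
      using K(2)
    proof (elim disjE conjE)
      assume "\<forall>i\<in>{2,3,6,7}. K i \<inter> outside_colors f S w0 = {}" "\<forall>i\<in>{0,1,3,5}. K i \<inter> outside_colors f S b = {}"
        "\<forall>i\<in>{0,1,2,4}. K i \<inter> outside_colors f S c = {}"
      \<comment> \<open>With the last three premises rotated to the front, the chained facts
        determine \<open>Pp\<close>, \<open>Pb\<close> and \<open>Pc\<close>; the six sets written
        out are the rest of the table.\<close>
      then show False
        by (rule extend[where Pq = "{0,1,5,10}" and Pr = "{2,4,8,9}" and Ps = "{0,1,6,7}" and Pt = "{5,8,9,10}"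
              and Pa = "{2,3,4,8}" and Pu = "{6,7,9,10}", rotated -3]) (use True in auto)
    next
      assume "\<forall>i\<in>{0,1,3,5}. K i \<inter> outside_colors f S w0 = {}" "\<forall>i\<in>{0,1,2,4}. K i \<inter> outside_colors f S b = {}"
        "\<forall>i\<in>{0,1,2,3}. K i \<inter> outside_colors f S c = {}"
      then show False
        by (rule extend[where Pq = "{2,8,9,10}" and Pr = "{3,5,6,7}" and Ps = "{0,2,4,10}" and Pt = "{6,7,8,9}"
              and Pa = "{1,3,6,7}" and Pu = "{5,8,9,10}", rotated -3]) (use True in auto)
    qed
  next
    case False
    show False
      using K(2)
    proof (elim disjE conjE)
      assume "\<forall>i\<in>{2,3,6,7}. K i \<inter> outside_colors f S w0 = {}" "\<forall>i\<in>{0,1,3,5}. K i \<inter> outside_colors f S b = {}"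
        "\<forall>i\<in>{0,1,2,4}. K i \<inter> outside_colors f S c = {}"
      then show False
        by (rule extend[where Pq = "{0,1,5,10}" and Pr = "{2,4,8,9}" and Ps = "{5,6,7,10}" and Pt = "{0,1,8,9}"
              and Pa = "{2,3,4,6}" and Pu = "{7,8,9,10}", rotated -3]) (use False in auto)
    next
      assume "\<forall>i\<in>{0,1,3,5}. K i \<inter> outside_colors f S w0 = {}" "\<forall>i\<in>{0,1,2,4}. K i \<inter> outside_colors f S b = {}"
        "\<forall>i\<in>{0,1,2,3}. K i \<inter> outside_colors f S c = {}"
      then show False
        by (rule extend[where Pq = "{2,4,9,10}" and Pr = "{3,6,7,8}" and Ps = "{4,5,9,10}" and Pt = "{2,6,7,8}"
              and Pa = "{0,1,3,5}" and Pu = "{6,7,8,10}", rotated -3]) (use False in auto)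
    qed
  qed
qed

text \<open>If \<open>w0\<close> is adjacent to \<open>b\<close>, start the cycle at
  \<open>w4\<close> instead: then \<open>w0\<close>, \<open>w1\<close>, \<open>w2\<close>,
  \<open>w3\<close> are attached to b, a, b, a, the alternating pattern. Otherwise \<open>w0\<close>
  is adjacent to neither \<open>b\<close> nor \<open>c\<close>, the latter because of the triangle
  with \<open>w4\<close>.\<close>

lemma no_five_cycle_abac:
  assumes cyc: "adj w0 w1" "adj w1 w2" "adj w2 w3" "adj w3 w4" "adj w4 w0"
    and att: "adj w1 a" "adj w2 b" "adj w3 a" "adj w4 c" "adj a u" "adj b u" "adj c u"
    and dist: "distinct [w0, w1, w2, w3, w4, a, b, c, u]"
    and u: "\<not> adj u w4"
  shows False
proof (cases "adj w0 b")
  case True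
  show False
    by (rule no_five_cycle_abab[of w4 w0 w1 w2 w3 b a u])
      (use True cyc att dist u in auto)
next
  case False
  moreover have "\<not> adj w0 c" using no_triangle[of w0 w4 c] cyc att adj_sym by blast
  ultimately show False
    by (intro no_five_cycle_three_attachments[OF cyc att(1,2,3,4,5,6,7) _ dist]) auto
qed

text \<open>Consecutive cycle vertices have different attachments for lack of triangles. Read along
  \<open>w1\<close>, ..., \<open>w4\<close>, the pattern is therefore abab, abac, its reversal abcb,
  or abca; a pattern with four different attachments would give \<open>u\<close> degree
  four.\<close>

lemma no_five_cycle_at_distance_two:
  assumes cyc: "adj w0 w1" "adj w1 w2" "adj w2 w3" "adj w3 w4" "adj w4 w0"
    and dw: "distinct [w0, w1, w2, w3, w4, u]"
    and att: "adj w1 y1" "adj w2 y2" "adj w3 y3" "adj w4 y4" "adj y1 u" "adj y2 u" "adj y3 u" "adj y4 u"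
    and u: "\<not> adj u w0" "\<not> adj u w1" "\<not> adj u w2" "\<not> adj u w3" "\<not> adj u w4"
  shows False
proof -
  note sym = cyc[THEN adj_sym] att[THEN adj_sym]
  have yw: "y \<notin> {w0, w1, w2, w3, w4, u}" if "adj y u" for y
    using that u adj_sym adj_neq by blast
  note yw' = yw[OF att(5)] yw[OF att(6)] yw[OF att(7)] yw[OF att(8)]
  have ne: "y1 \<noteq> y2" "y2 \<noteq> y3" "y3 \<noteq> y4"
    using no_triangle[of w1 w2 y1] no_triangle[of w2 w3 y2] no_triangle[of w3 w4 y3] cyc att by blast+
  consider "y1 = y3" "y2 = y4" | "y1 = y3" "y2 \<noteq> y4" | "y1 \<noteq> y3" "y2 = y4" | "y1 \<noteq> y3" "y2 \<noteq> y4" by blast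
  then show False
  proof cases
    case 1
    show False
      by (rule no_five_cycle_abab[of w0 w1 w2 w3 w4 y1 y2 u]) (use 1 cyc att dw u ne yw' in auto)
  next
    case 2
    show False
      by (rule no_five_cycle_abac[of w0 w1 w2 w3 w4 y1 y2 y4 u]) (use 2 cyc att dw u ne yw' in auto)
  next
    case 3
    show False
      by (rule no_five_cycle_abac[of w0 w4 w3 w2 w1 y2 y3 y1 u]) (use 3 sym att dw u ne yw' in auto)
  next
    case 4
    have "adj u y4 \<longleftrightarrow> y4 = y1 \<or> y4 = y2 \<or> y4 = y3"
      by (rule nbrs_eq) (use sym ne 4 in auto)
    then have y4: "y4 = y1" using sym ne 4 by blast
    have dist: "distinct [w0, w1, w2, w3, w4, y1, y2, y3, u]" using dw ne 4 yw' by auto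
    \<comment> \<open>The pattern is abca. If \<open>w0\<close> is attached to \<open>y2\<close> or
      \<open>y3\<close> as well, another cycle vertex can play the part of \<open>w0\<close>, and
      the remaining four show the alternating pattern.\<close>
    show False
    proof (cases "adj w0 y2 \<or> adj w0 y3")
      case True
      then show False
      proof
        assume "adj w0 y2"
        then show False
          by (intro no_five_cycle_abab[of w3 w4 w0 w1 w2 y1 y2 u]) (use y4 cyc att dist u in auto)
      next
        assume "adj w0 y3"
        then show False
          by (intro no_five_cycle_abab[of w2 w3 w4 w0 w1 y3 y1 u]) (use y4 cyc att dist u in auto)
      qed
    next
      case False
      show False
        by (rule no_five_cycle_three_attachments[of w0 w1 w2 w3 w4 y1 y2 w4 w3 y3 u])
          (use False y4 cyc att dist in auto)
    qed
  qed
qed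

end

section \<open>Admissible sets\<close>

context critical_subcubic
begin

lemma path_nbrsI:
  assumes "set p \<subseteq> pverts G" "set (vwalk_arcs p) \<subseteq> parcs G" "distinct p" "2 \<le> length p"
  shows "last p \<in> path_nbrs G (length p - 1) (hd p)"
proof -
  have "hd p \<noteq> last p" using assms(3,4) by (cases p) auto
  moreover have "vpath p G" using assms by (auto simp: vpath_def vwalk_def)
  moreover have "last p \<in> pverts G" using assms(1,4) last_in_set[of p] by fastforce
  ultimately show ?thesis by (auto simp: path_nbrs_def)
qed

end

section \<open>The precolouring and the lists given by one admissible set\<close>

locale admissible_partition = critical_subcubic +
  fixes P :: "nat \<Rightarrow> 'a set" and X :: "'a set"
  assumes X_verts: "X \<subseteq> pverts G" and part: "partition_into X 3 P"
    and same: "\<And>i u v. i < 3 \<Longrightarrow> u \<in> P i \<Longrightarrow> v \<in> P i \<Longrightarrow>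
      v \<notin> path_nbrs G 1 u \<union> path_nbrs G 3 u \<union> path_nbrs G 5 u"
    and diff: "\<And>i j u v. i < 3 \<Longrightarrow> j < 3 \<Longrightarrow> i \<noteq> j \<Longrightarrow> u \<in> P i \<Longrightarrow> v \<in> P j \<Longrightarrow>
      v \<notin> path_nbrs G 1 u \<union> path_nbrs G 2 u \<union> path_nbrs G 4 u"
begin

definition NX :: "nat \<Rightarrow> 'a set" where
  "NX i = {y. \<exists>x\<in>P i. adj x y}"

definition R :: "'a set" where
  "R = pverts G - X - (\<Union>i<3. NX i)"

text \<open>The vertices of \<open>NX i\<close> are going to receive colour \<open>i\<close>, so
  their neighbours have to give it up.\<close>

definition L :: "'a \<Rightarrow> nat set" where
  "L y = {0, 1, 2} - {i. i < 3 \<and> (\<exists>p\<in>NX i. adj y p)}"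

lemma P_sub: "i < 3 \<Longrightarrow> P i \<subseteq> X" and P_cover: "x \<in> X \<Longrightarrow> \<exists>i<3. x \<in> P i"
  and P_disj: "i < 3 \<Longrightarrow> j < 3 \<Longrightarrow> i \<noteq> j \<Longrightarrow> P i \<inter> P j = {}"
  using part unfolding partition_into_def disjoint_family_on_def by auto

lemma X_indep:
  assumes "x \<in> X" "y \<in> X"
  shows "\<not> adj x y"
proof
  assume a: "adj x y"
  have "y \<in> path_nbrs G 1 x"
    using path_nbrsI[of "[x, y]"] a adj_neq[OF a] adj_verts[OF a] by simp
  moreover obtain i j where ij: "i < 3" "x \<in> P i" "j < 3" "y \<in> P j" using assms P_cover by meson
  ultimately show False using same[of i x y] diff[of i j x y] by (cases "i = j") auto
qed

lemma NX_disj: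
  assumes "i < 3" "j < 3" "i \<noteq> j" "y \<in> NX i" "y \<in> NX j"
  shows False
proof -
  obtain x x' where x: "x \<in> P i" "adj x y" "x' \<in> P j" "adj x' y" using assms by (auto simp: NX_def)
  have "x \<noteq> x'" using P_disj[of i j] assms x by blast
  then have "x' \<in> path_nbrs G 2 x"
    using path_nbrsI[of "[x, y, x']"] x adj_sym[OF x(4)] adj_neq[OF x(2)] adj_neq[OF x(4)]
      adj_verts[OF x(2)] adj_verts[OF x(4)] by (simp add: numeral_2_eq_2)
  then show False using diff[of i j x x'] assms x by blast
qed

lemma NX_not_X: "i < 3 \<Longrightarrow> y \<in> NX i \<Longrightarrow> y \<notin> X"
  using X_indep P_sub by (auto simp: NX_def)

lemma NX_indep:
  assumes "i < 3" "p \<in> NX i" "q \<in> NX i"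
  shows "\<not> adj p q"
proof
  assume pq: "adj p q"
  obtain x x' where x: "x \<in> P i" "adj x p" "x' \<in> P i" "adj x' q" using assms by (auto simp: NX_def)
  have "x \<noteq> x'" using no_triangle[OF x(2) pq] x by blast
  moreover have "p \<notin> X" "q \<notin> X" using assms NX_not_X by blast+
  moreover have "x \<in> X" "x' \<in> X" using x P_sub assms by blast+
  ultimately have "distinct [x, p, q, x']" using adj_neq[OF pq] by auto
  then have "x' \<in> path_nbrs G 3 x"
    using path_nbrsI[of "[x, p, q, x']"] x pq adj_sym[OF x(4)] adj_verts[OF x(2)] adj_verts[OF x(4)]
    by (simp add: numeral_3_eq_3)
  then show False using same[of i x x'] assms x by blast
qed

lemma NX_unique:
  assumes y: "y \<in> R" and ij: "i < 3" "j < 3" and p: "p \<in> NX i" "adj y p" and q: "q \<in> NX j" "adj y q"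
  shows "i = j"
proof (rule ccontr)
  assume ne: "i \<noteq> j"
  obtain x x' where x: "x \<in> P i" "adj x p" "x' \<in> P j" "adj x' q" using p q by (auto simp: NX_def)
  have "x \<noteq> x'" using P_disj[of i j] ij ne x by blast
  moreover have "p \<noteq> q" using NX_disj[OF ij ne] p q by blast
  moreover have "p \<notin> X" "q \<notin> X" using ij p q NX_not_X by blast+
  moreover have "x \<in> X" "x' \<in> X" using x P_sub ij by blast+
  moreover have "y \<notin> X" using y by (simp add: R_def)
  ultimately have "distinct [x, p, y, q, x']" using adj_neq[OF p(2)] adj_neq[OF q(2)] by auto
  then have "x' \<in> path_nbrs G 4 x"
    using path_nbrsI[of "[x, p, y, q, x']"] x p q adj_sym[OF x(4)] adj_sym[OF p(2)]
      adj_verts[OF x(2)] adj_verts[OF x(4)] adj_verts[OF p(2)]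
    by (simp add: eval_nat_numeral)
  then show False using diff[of i j x x'] ij ne x by blast
qed

text \<open>Two different roots would be the ends of the path x, p, y, z, q, x' of length 5; here
  \<open>p\<close> and \<open>q\<close> differ because a common neighbour of \<open>y\<close> and
  \<open>z\<close> would complete a triangle. Adjacent vertices that miss the same colour thus owe
  it to the same vertex of \<open>X\<close>.\<close>

lemma common_root:
  assumes yz: "y \<in> R" "z \<in> R" "adj y z" and i: "i < 3"
    and x: "x \<in> P i" "adj x p" "adj y p" and x': "x' \<in> P i" "adj x' q" "adj z q"
  shows "x' = x"
proof (rule ccontr)
  assume ne: "x' \<noteq> x"
  have pq: "p \<in> NX i" "q \<in> NX i" using x x' by (auto simp: NX_def)
  have "p \<noteq> q" using no_triangle[OF yz(3) x'(3)] x by blast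
  moreover have "p \<notin> X" "q \<notin> X" using i pq NX_not_X by blast+
  moreover have "p \<notin> R" "q \<notin> R" using i pq by (auto simp: R_def)
  moreover have "x \<in> X" "x' \<in> X" using x x' P_sub i by blast+
  moreover have "y \<notin> X" "z \<notin> X" using yz by (auto simp: R_def)
  ultimately have "distinct [x, p, y, z, q, x']" using ne yz adj_neq[OF yz(3)] by auto
  then have "x' \<in> path_nbrs G 5 x"
    using path_nbrsI[of "[x, p, y, z, q, x']"] x x' yz adj_sym[OF x(3)] adj_sym[OF x'(2)]
      adj_verts[OF x(2)] adj_verts[OF x'(2)] adj_verts[OF yz(3)]
    by (simp add: eval_nat_numeral)
  then show False using same[of i x x'] i x x' by blast
qed

lemma L_cases:
  assumes "y \<in> R"
  obtains "L y = {0, 1, 2}" "\<And>i p. i < 3 \<Longrightarrow> p \<in> NX i \<Longrightarrow> \<not> adj y p"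
  | i p where "i < 3" "p \<in> NX i" "adj y p" "L y = {0, 1, 2} - {i}"
proof (cases "\<exists>i<3. \<exists>p\<in>NX i. adj y p")
  case True
  then obtain i p where ip: "i < 3" "p \<in> NX i" "adj y p" by blast
  then have "{j. j < 3 \<and> (\<exists>p\<in>NX j. adj y p)} = {i}"
    using NX_unique[OF assms] by blast
  then show ?thesis using that(2) ip by (simp add: L_def)
next
  case False
  then have "{j. j < 3 \<and> (\<exists>p\<in>NX j. adj y p)} = {}" by blast
  then have "L y = {0, 1, 2}" by (simp only: L_def Diff_empty)
  then show ?thesis using that(1) False by blast
qed

lemma card_remove_color: "i < 3 \<Longrightarrow> card ({0, 1, 2::nat} - {i}) = 2"
  by (auto simp: card_Diff_singleton_if)

text \<open>A lost colour is paid for by a lost neighbour: the vertex \<open>p\<close> responsible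
  for it lies outside \<open>R\<close>. With degree at most three, two colours then face at most two
  neighbours in \<open>R\<close>.\<close>

lemma card_nbrs_le_L:
  assumes y: "y \<in> R"
  shows "card (nbrs_in adj R y) \<le> card (L y)"
  using y
proof (cases rule: L_cases)
  case 1
  have "card (nbrs_in adj R y) \<le> card {t. adj y t}"
    using card_nbrs by (intro card_mono) (auto simp: nbrs_in_def)
  then show ?thesis using card_nbrs[of y] 1 by simp
next
  case (2 i p)
  have "card (nbrs_in adj R y) \<le> card ({t. adj y t} - {p})"
    using card_nbrs 2 by (intro card_mono) (auto simp: nbrs_in_def R_def)
  moreover have "card ({t. adj y t} - {p}) = card {t. adj y t} - 1"
    using 2 by (simp add: card_Diff_singleton)
  moreover have "card {t. adj y t} \<le> 3" using card_nbrs by blast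
  moreover have "card (L y) = 2" using 2 card_remove_color[of i] by simp
  ultimately show ?thesis by linarith
qed

lemma no_leaf:
  assumes leaf: "uncolorable_leaf adj Q L w K" and Q: "closed_in adj R Q"
  shows False
proof -
  interpret uncolorable_leaf adj Q L w K by (rule leaf)
  have QR: "Q \<subseteq> R" using Q by (simp add: closed_in_def)
  have KR: "K \<subseteq> R" using K_sub QR by blast
  have QX: "t \<notin> Q" if "t \<in> X \<or> (\<exists>i<3. t \<in> NX i)" for t
    using that QR by (auto simp: R_def)
  \<comment> \<open>Full lists on all of \<open>K\<close> are ruled out by \<open>not_cubic\<close>.
    Since the lists are constant on \<open>K\<close>, one missing colour is then missing at every
    vertex of \<open>K\<close>.\<close>
  have "\<exists>k\<in>K. L k \<noteq> {0, 1, 2}"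
  proof (rule ccontr)
    assume "\<not> ?thesis"
    then have full: "L k = {0, 1, 2}" if "k \<in> K" for k using that by blast
    have sub: "L y \<subseteq> {0, 1, 2}" for y unfolding L_def by (rule Diff_subset)
    show False by (rule not_cubic[OF full sub no_triangle])
  qed
  then obtain k0 where k0: "k0 \<in> K" "L k0 \<noteq> {0, 1, 2}" by blast
  then have "k0 \<in> R" using KR by blast
  then obtain i p0 where i: "i < 3" "p0 \<in> NX i" "adj k0 p0" "L k0 = {0, 1, 2} - {i}"
    by (cases rule: L_cases) (use k0 in auto)
  have LK: "L y = {0, 1, 2} - {i}" if "y \<in> K" for y using L_const[OF k0(1) that] i by simp
  have two: "card (L y) = 2" if "y \<in> K" for y using LK[OF that] card_remove_color i by simp
  obtain u where u: "u \<in> P i" "adj u p0" using i by (auto simp: NX_def)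
  have uX: "u \<in> X" using u i P_sub by blast
  have root: "\<exists>p. adj y p \<and> adj p u" if "y \<in> K" for y
  proof (rule K_induct[OF k0(1) _ _ that])
    show "\<exists>p. adj k0 p \<and> adj p u" using i u adj_sym by blast
  next
    fix y z assume yz: "y \<in> K" "z \<in> K" "adj y z" "\<exists>p. adj y p \<and> adj p u"
    then obtain p where p: "adj y p" "adj p u" by blast
    have "i \<notin> L z" using LK[OF yz(2)] by simp
    then obtain q where q: "q \<in> NX i" "adj z q" using i(1) by (auto simp: L_def)
    then obtain x' where x': "x' \<in> P i" "adj x' q" by (auto simp: NX_def)
    have "x' = u"
      using common_root[of y z i u p x' q] yz KR i(1) u(1) p q x' adj_sym by blast
    then show "\<exists>p. adj z p \<and> adj p u" using q x' adj_sym by blast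
  qed
  \<comment> \<open>The vertices reached from \<open>u\<close> in two steps: at most three
    neighbours with at most two further neighbours each, hence at most six.\<close>
  define M where "M = (\<Union>p\<in>{p. adj u p}. {t. adj p t} - {u})"
  have KM: "K \<subseteq> M"
  proof
    fix y assume y: "y \<in> K"
    then obtain p where p: "adj y p" "adj p u" using root by blast
    have "y \<noteq> u" using QX[of u] uX y K_sub by blast
    then show "y \<in> M" using adj_sym[OF p(1)] adj_sym[OF p(2)] by (auto simp: M_def)
  qed
  have M1: "card ({t. adj p t} - {u}) \<le> 2" if "adj u p" for p
    using conjunct2[OF card_nbrs, of p] adj_sym[OF that] by (simp add: card_Diff_singleton)
  have "card M \<le> (\<Sum>p\<in>{p. adj u p}. card ({t. adj p t} - {u}))"
    unfolding M_def using card_nbrs[of u] by (intro card_UN_le) simp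
  also have "\<dots> \<le> (\<Sum>p\<in>{p. adj u p}. 2)" by (intro sum_mono) (use M1 in blast)
  also have "\<dots> \<le> 6" using conjunct2[OF card_nbrs, of u] by simp
  finally have M6: "card M \<le> 6" .
  have finM: "finite M" unfolding M_def using card_nbrs by blast
  obtain m v where v: "v 0 = w" "inj_on v {..m}" "K = v ` {1..m}"
    "\<And>i. i < m \<Longrightarrow> adj (v i) (v (Suc i))" "adj (v m) (v 0)" "even m" "2 \<le> m"
    using leaf_is_even_path[OF two] by blast
  have "inj_on v {1..m}" using v(2) by (rule inj_on_subset) auto
  then have cardK: "card K = m" using v(3) by (simp add: card_image)
  then have "m \<le> 6" using card_mono[OF finM KM] M6 by simp
  moreover have "m \<noteq> 2"
    using v(4)[of 0] v(4)[of 1] v(5) no_triangle[of "v 0" "v 1" "v 2"] adj_sym by (auto simp: numeral_2_eq_2)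
  ultimately have "m = 4 \<or> m = 6" using v(6,7) by presburger
  then consider "m = 4" | "m = 6" by blast
  then show False
  proof cases
    case 1
    have vQ: "v i \<in> Q" if "i \<le> 4" for i
      using that v(1,3) 1 K_sub w by (cases "i = 0") auto
    have vK: "v i \<in> K" if "1 \<le> i" "i \<le> 4" for i using that v(3) 1 by auto
    have v_eq: "v i = v j \<longleftrightarrow> i = j" if "i \<le> 4" "j \<le> 4" for i j
      using v(2) 1 that by (auto simp: inj_on_def)
    have vu: "v i \<noteq> u" if "i \<le> 4" for i using vQ[OF that] QX[of u] uX by blast
    have d: "distinct [v 0, v 1, v 2, v 3, v 4, u]" by (simp add: v_eq vu)
    have nu: "\<not> adj u (v i)" if "i \<le> 4" for i
      using vQ[OF that] QX[of "v i"] u(1) i(1) by (auto simp: NX_def)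
    obtain y1 y2 y3 y4 where "adj (v 1) y1" "adj y1 u" "adj (v 2) y2" "adj y2 u"
      "adj (v 3) y3" "adj y3 u" "adj (v 4) y4" "adj y4 u"
      using root[OF vK[of 1]] root[OF vK[of 2]] root[OF vK[of 3]] root[OF vK[of 4]] by auto
    then show False
      using no_five_cycle_at_distance_two[of "v 0" "v 1" "v 2" "v 3" "v 4" u y1 y2 y3 y4]
        v(4)[of 0] v(4)[of 1] v(4)[of 2] v(4)[of 3] v(5) d nu[of 0] nu[of 1] nu[of 2] nu[of 3] nu[of 4] 1
      by (simp add: eval_nat_numeral)
  next
    case 2
    \<comment> \<open>The seven-cycle attains the bound, so a neighbour of \<open>u\<close> has no
      neighbours besides \<open>u\<close> and vertices of \<open>K\<close>.\<close>
    have KM': "K = M" by (rule card_seteq[OF finM KM]) (use cardK M6 2 in simp)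
    have pK: "t \<in> K" if "adj u p" "adj p t" "t \<noteq> u" for p t
      using that by (auto simp: KM' M_def)
    have nuQ: "\<not> adj u t" if "t \<in> Q" for t
      using that QX[of t] u(1) i(1) by (auto simp: NX_def)
    have wu: "w \<noteq> u" using w QX[of u] uX by blast
    have v_eq: "v i = v j \<longleftrightarrow> i = j" if "i \<le> 6" "j \<le> 6" for i j
      using v(2) 2 that by (auto simp: inj_on_def)
    \<comment> \<open>An inner vertex \<open>v i\<close> of the path already has its two neighbours
      in \<open>Q\<close> on the path, so it cannot be adjacent to \<open>w\<close> as well.\<close>
    have w_nb: "t = v 1 \<or> t = v 6" if t: "t \<in> K" "adj w t" for t
    proof -
      obtain i where i: "1 \<le> i" "i \<le> 6" "t = v i" using t v(3) 2 by auto
      show ?thesis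
      proof (rule ccontr)
        assume ne: "\<not> ?thesis"
        then have i': "1 < i" "i < 6" using i by (auto simp: le_less)
        have vQ: "v j \<in> Q" if "j \<le> 6" for j
          using that v(1,3) 2 K_sub w by (cases "j = 0") auto
        obtain j where j: "i = Suc j" using i' by (cases i) auto
        have sub: "{v j, v (Suc i), w} \<subseteq> nbrs_in adj Q (v i)"
          using v(4)[of i] v(4)[of j] t i i' j 2 vQ w adj_sym by (auto simp: nbrs_in_def)
        moreover have "card {v j, v (Suc i), w} = 3"
          using v_eq[of j "Suc i"] v_eq[of j 0] v_eq[of "Suc i" 0] i' j v(1) by simp
        moreover have "card (nbrs_in adj Q (v i)) = 2"
          using tight[of "v i"] two[of "v i"] t i K_sub by auto
        ultimately show False using card_mono[OF finite_nbrs[OF subset_refl] sub] by linarith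
      qed
    qed
    define H where "H = K \<union> {w, u} \<union> {p. adj u p}"
    \<comment> \<open>If all neighbours of \<open>w\<close> were in \<open>H\<close>, they would all
      be in \<open>K\<close>: a common neighbour of \<open>w\<close> and \<open>u\<close> would put
      \<open>w\<close> into \<open>M\<close>. Then \<open>w\<close> misses no colour and tightness
      requires three neighbours in \<open>Q\<close>, while only \<open>v 1\<close> and
      \<open>v 6\<close> are available.\<close>
    have "\<exists>z. adj w z \<and> z \<notin> H"
    proof (rule ccontr)
      assume "\<not> ?thesis"
      then have wH: "t \<in> H" if "adj w t" for t using that by blast
      have "\<not> adj w u" using nuQ[OF w] adj_sym by blast
      then have wK: "t \<in> K" if t: "adj w t" for t
      proof -
        have "\<not> adj u t" using pK[of t w] adj_sym[OF t] wu K_sub by blast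
        moreover have "t \<noteq> u" "t \<noteq> w" using t \<open>\<not> adj w u\<close> adj_neq[OF t] by blast+
        ultimately show ?thesis using wH[OF t] by (simp add: H_def)
      qed
      have "L w = {0, 1, 2}"
      proof -
        have "{i. i < 3 \<and> (\<exists>p\<in>NX i. adj w p)} = {}" using wK KR by (auto simp: R_def)
        then show ?thesis by (simp only: L_def Diff_empty)
      qed
      then have "card (nbrs_in adj Q w) = 3" using tight[OF w] by simp
      moreover have "nbrs_in adj Q w \<subseteq> {v 1, v 6}" using wK w_nb by (auto simp: nbrs_in_def)
      then have "card (nbrs_in adj Q w) \<le> 2"
        using card_mono[of "{v 1, v 6}" "nbrs_in adj Q w"] v_eq[of 1 6] by simp
      ultimately show False by simp
    qed
    then obtain z where z: "adj w z" "z \<notin> H" by blast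
    have z16: "z \<noteq> v 1" "z \<noteq> v 6" using z v(3) 2 by (auto simp: H_def)
    have a16: "adj w (v 1)" "adj w (v 6)" using v(1,5) v(4)[of 0] 2 adj_sym by auto
    have wz: "t = v 1 \<or> t = v 6 \<or> t = z" if "adj w t" for t
      using nbrs_eq(1)[OF a16 z(1), of t] that z16 v_eq[of 1 6] by auto
    \<comment> \<open>Two neighbours in \<open>Q\<close> and one neighbour of \<open>u\<close> use
      up the degree of a vertex of \<open>K\<close>.\<close>
    have KH: "t \<in> H" if y: "y \<in> K" "adj y t" for y t
    proof -
      obtain p where p: "adj y p" "adj p u" using root[OF y(1)] by blast
      have pQ: "p \<notin> Q" using nuQ adj_sym p by blast
      have "finite {s. adj y s}" "card {s. adj y s} \<le> 3" using card_nbrs by blast+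
      moreover have "insert p (nbrs_in adj Q y) \<subseteq> {s. adj y s}" using p by (auto simp: nbrs_in_def)
      moreover have "card (insert p (nbrs_in adj Q y)) = 3"
        using tight[of y] two[OF y(1)] y K_sub pQ finite_nbrs[of Q y] by (auto simp: nbrs_in_def)
      ultimately have "insert p (nbrs_in adj Q y) = {s. adj y s}" by (intro card_seteq) auto
      then have "t = p \<or> t \<in> Q" using y by (auto simp: nbrs_in_def)
      then show ?thesis
        using K_closed[OF y(1), of t] y p adj_sym by (auto simp: H_def)
    qed
    show False
    proof (rule no_bridge[of w H z])
      fix y t assume yt: "y \<in> H" "t \<notin> H" "adj y t"
      have "y \<notin> K" using KH yt by blast
      moreover have "y \<noteq> u" using yt by (auto simp: H_def)
      moreover have "\<not> adj u y" using pK[of y t] yt by (auto simp: H_def)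
      ultimately have "y = w" using yt by (auto simp: H_def)
      then show "y = w \<and> t = z" using wz[of t] yt v(3) 2 by (auto simp: H_def)
    qed (use z in \<open>auto simp: H_def\<close>)
  qed
qed

lemma R_colorable: "\<exists>f. list_coloring adj L R f"
proof (rule ccontr)
  assume no: "\<not> ?thesis"
  have finR: "finite R" using pair_finite_verts by (simp add: R_def)
  have irr: "irreflp adj" using adj_neq by (auto simp: irreflp_def)
  have sym: "symp adj" using adj_sym by (auto simp: symp_def)
  have finL: "finite (L y)" for y by (simp add: L_def)
  obtain Q where Q: "closed_in adj R Q" "\<nexists>f. list_coloring adj L Q f"
    "\<And>T. T \<subset> Q \<Longrightarrow> \<exists>f. list_coloring adj L T f"
    "\<And>v. v \<in> Q \<Longrightarrow> card (L v) = card (nbrs_in adj Q v)"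
    using list_coloring_minimal_obstruction[OF finR irr sym finL card_nbrs_le_L no] by metis
  have "finite Q" using Q(1) finR finite_subset by (auto simp: closed_in_def)
  then interpret uncolorable adj Q L
    using irr sym finL Q by unfold_locales auto
  have "L y \<noteq> {}" if "y \<in> Q" for y
  proof -
    have "y \<in> R" using that Q(1) by (auto simp: closed_in_def)
    then show ?thesis by (cases rule: L_cases) (use card_remove_color in fastforce)+
  qed
  then obtain w K where "uncolorable_leaf adj Q L w K" using leaf_exists by metis
  then show False using no_leaf Q(1) by blast
qed

lemma coloring_with_spare_color:
  obtains S where "\<And>v. v \<in> pverts G \<Longrightarrow> S v \<subseteq> {..<3::nat} \<and> card (S v) = (if v \<in> X then 2 else 1)"
    "\<And>u v. adj u v \<Longrightarrow> S u \<inter> S v = {}"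
proof -
  obtain f where f: "list_coloring adj L R f" using R_colorable by blast
  define S where "S v = (if v \<in> X then {0, 1, 2} - {i. i < 3 \<and> v \<in> P i}
    else if v \<in> (\<Union>i<3. NX i) then {i. i < 3 \<and> v \<in> NX i} else {f v})" for v
  have SX: "S v = {0, 1, 2} - {i}" if "i < 3" "v \<in> P i" for v i
  proof -
    have "{j. j < 3 \<and> v \<in> P j} = {i}" using that P_disj by blast
    then show ?thesis using that P_sub by (auto simp: S_def)
  qed
  have SN: "S v = {i}" if "i < 3" "v \<in> NX i" for v i
  proof -
    have "{j. j < 3 \<and> v \<in> NX j} = {i}" using that NX_disj by blast
    then show ?thesis using that NX_not_X by (auto simp: S_def)
  qed
  have SR: "S v = {f v}" "f v \<in> L v" if "v \<in> R" for v
    using that f by (auto simp: S_def R_def list_coloring_def)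
  have cover: "(\<exists>i<3. v \<in> P i) \<or> (\<exists>i<3. v \<in> NX i) \<or> v \<in> R" if "v \<in> pverts G" for v
    using that P_cover by (auto simp: R_def)
  \<comment> \<open>Adjacent pairs are treated up to order only; the reversed pairs follow from the
    symmetry of adjacency.\<close>
  have half: "S u \<inter> S v = {}" if a: "adj u v"
    and c: "(\<exists>i<3. u \<in> P i) \<or> (\<exists>i<3. u \<in> NX i \<and> (v \<in> R \<or> (\<exists>j<3. v \<in> NX j))) \<or> u \<in> R \<and> v \<in> R" for u v
    using c
  proof (elim disjE exE conjE)
    fix i assume i: "i < 3" "u \<in> P i"
    then have "v \<in> NX i" using a by (auto simp: NX_def)
    then show ?thesis using SX[OF i] SN[of i v] i by simp
  next
    fix i assume i: "i < 3" "u \<in> NX i" "v \<in> R"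
    then have "i \<notin> L v" using adj_sym[OF a] by (auto simp: L_def)
    then show ?thesis using SN[of i u] SR[of v] i by auto
  next
    fix i j assume i: "i < 3" "u \<in> NX i" "j < 3" "v \<in> NX j"
    then have "i \<noteq> j" using NX_indep a by blast
    then show ?thesis using SN[of i u] SN[of j v] i by simp
  next
    assume uv: "u \<in> R" "v \<in> R"
    then have "f u \<noteq> f v" using f a by (auto simp: list_coloring_def)
    then show ?thesis using SR(1) uv by simp
  qed
  show ?thesis
  proof (rule that[of S])
    fix v assume "v \<in> pverts G"
    then consider i where "i < 3" "v \<in> P i" | i where "i < 3" "v \<in> NX i" | "v \<in> R" using cover by blast
    then show "S v \<subseteq> {..<3} \<and> card (S v) = (if v \<in> X then 2 else 1)"
    proof cases
      case (1 i)
      then have "v \<in> X" using P_sub by blast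
      moreover have "card (S v) = 2" unfolding SX[OF 1] by (rule card_remove_color[OF 1(1)])
      moreover have "S v \<subseteq> {..<3}" unfolding SX[OF 1] by auto
      ultimately show ?thesis by simp
    next
      case (2 i)
      then show ?thesis using SN[OF 2] NX_not_X[OF 2] by simp
    next
      case 3
      then have "v \<notin> X" by (simp add: R_def)
      moreover have "f v \<in> {0, 1, 2}" using SR(2)[OF 3] unfolding L_def by blast
      ultimately show ?thesis using SR(1)[OF 3] by auto
    qed
  next
    fix u v assume a: "adj u v"
    show "S u \<inter> S v = {}"
      using cover[of u] cover[of v] adj_verts[OF a] half[OF a] half[OF adj_sym[OF a]] by blast
  qed
qed

end

lemma (in critical_subcubic) admissible_coloring:
  assumes "admissible G X"
  obtains S where "\<And>v. v \<in> pverts G \<Longrightarrow> S v \<subseteq> {..<3::nat} \<and> card (S v) = (if v \<in> X then 2 else 1)"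
    "\<And>u v. adj u v \<Longrightarrow> S u \<inter> S v = {}"
proof -
  obtain P where P: "partition_into X 3 P"
    "\<forall>i<3. \<forall>u \<in> P i. \<forall>v \<in> P i. v \<notin> path_nbrs G 1 u \<union> path_nbrs G 3 u \<union> path_nbrs G 5 u"
    "\<forall>i<3. \<forall>j<3. i \<noteq> j \<longrightarrow> (\<forall>u \<in> P i. \<forall>v \<in> P j. v \<notin> path_nbrs G 1 u \<union> path_nbrs G 2 u \<union> path_nbrs G 4 u)"
    using assms unfolding admissible_def by blast
  interpret admissible_partition G P X
    using assms P by unfold_locales (simp_all add: admissible_def)
  show ?thesis using coloring_with_spare_color that by blast
qed

theorem theorem4:
  fixes G :: "'a pair_pre_digraph" and k :: nat
  assumes "pair_graph G"
    and "fractionally_critical G"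
    and "triangle_free G"
    and "\<forall>v \<in> pverts G. out_degree G v \<le> 3"
    and "11 / 4 < fractional_chromatic_number G"
    and "fractional_chromatic_number G < 3"
    and "\<exists>P. partition_into (pverts G) k P \<and> (\<forall>i<k. admissible G (P i))"
  shows "fractional_chromatic_number G \<le> 3 - 3 / (real k + 1)"
proof -
  interpret critical_subcubic G using assms by (simp add: critical_subcubic_def)
  obtain P where P: "partition_into (pverts G) k P" "\<And>i. i < k \<Longrightarrow> admissible G (P i)"
    using assms(7) by blast
  have "\<exists>S. (\<forall>v\<in>pverts G. S v \<subseteq> {..<3::nat} \<and> card (S v) = (if v \<in> P i then 2 else 1)) \<and>
      (\<forall>u v. adj u v \<longrightarrow> S u \<inter> S v = {})" if "i < k" for i
    using admissible_coloring[OF P(2)[OF that]] by metis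
  then obtain S where S: "\<And>i v. i < k \<Longrightarrow> v \<in> pverts G \<Longrightarrow> S i v \<subseteq> {..<3::nat}"
    "\<And>i v. i < k \<Longrightarrow> v \<in> pverts G \<Longrightarrow> card (S i v) = (if v \<in> P i then 2 else 1)"
    "\<And>i u v. i < k \<Longrightarrow> adj u v \<Longrightarrow> S i u \<inter> S i v = {}"
    by metis
  \<comment> \<open>The index is unique because the parts are disjoint. This makes the number of
    colours at a vertex exactly \<open>k + 1\<close>, as an exact set size is required.\<close>
  have cover: "\<exists>i<k. v \<in> P i \<and> (\<forall>j<k. v \<in> P j \<longrightarrow> j = i)" if "v \<in> pverts G" for v
    using P(1) that unfolding partition_into_def disjoint_family_on_def by blast
  \<comment> \<open>A palette must be non-empty, so \<open>3 * k\<close> needs \<open>k\<close>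
    positive. For \<open>k = 0\<close> there are no vertices, and a vacuous colouring of ratio 1
    contradicts \<open>large\<close>.\<close>
  have "k \<noteq> 0"
  proof
    assume "k = 0"
    then have "pverts G = {}" using cover by blast
    then have "fold_coloring G 1 1 (\<lambda>_. {})" by (simp add: fold_coloring_def)
    then show False using fractional_chromatic_number_le[of G 1 1] large by fastforce
  qed
  define c where "c v = (\<Union>i<k. (\<lambda>q. 3 * i + q) ` S i v)" for v
  have "fold_coloring G (3 * k) (k + 1) c"
    unfolding fold_coloring_def
  proof (intro conjI ballI impI)
    fix v assume v: "v \<in> pverts G"
    show "c v \<subseteq> {..<3 * k}" using S(1)[OF _ v] by (fastforce simp: c_def)
    have fin: "finite (S i v)" if "i < k" for i using S(1)[OF that v] finite_subset by blast
    have "card (c v) = (\<Sum>i<k. card ((\<lambda>q. 3 * i + q) ` S i v))"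
      unfolding c_def
    proof (rule card_UN_disjoint)
      show "\<forall>i\<in>{..<k}. \<forall>j\<in>{..<k}. i \<noteq> j \<longrightarrow> (\<lambda>q. 3 * i + q) ` S i v \<inter> (\<lambda>q. 3 * j + q) ` S j v = {}"
      proof (intro ballI impI equals0I)
        fix i j x assume ij: "i \<in> {..<k}" "j \<in> {..<k}" "i \<noteq> j"
          and x: "x \<in> (\<lambda>q. 3 * i + q) ` S i v \<inter> (\<lambda>q. 3 * j + q) ` S j v"
        then obtain q r where "q \<in> S i v" "r \<in> S j v" "3 * i + q = 3 * j + r" by auto
        moreover from this have "q < 3" "r < 3" using S(1)[OF _ v] ij by blast+
        ultimately show False using ij(3) by linarith
      qed
    qed (use fin in auto)
    also have "\<dots> = (\<Sum>i<k. card (S i v))"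
      by (intro sum.cong refl card_image) (simp add: inj_on_def)
    also have "\<dots> = (\<Sum>i<k. 1 + (if v \<in> P i then 1 else 0))"
      by (rule sum.cong) (use S(2)[OF _ v] in auto)
    also have "\<dots> = k + 1"
    proof -
      obtain i where i: "i < k" "\<And>j. j < k \<Longrightarrow> v \<in> P j \<longleftrightarrow> j = i" using cover[OF v] by metis
      have "(\<Sum>j<k. if v \<in> P j then 1 else 0) = (\<Sum>j<k. if j = i then 1 else 0 :: nat)"
        by (rule sum.cong) (simp_all add: i(2))
      then have "(\<Sum>j<k. if v \<in> P j then 1 else 0) = (1 :: nat)" using i(1) by simp
      then show ?thesis by (simp only: sum.distrib) simp
    qed
    finally show "card (c v) = k + 1" .
  next
    fix u v assume uv: "u \<in> pverts G" "v \<in> pverts G" "u \<rightarrow>\<^bsub>with_proj G\<^esub> v"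
    show "c u \<inter> c v = {}"
    proof (rule ccontr)
      assume "c u \<inter> c v \<noteq> {}"
      then obtain i j q r where q: "i < k" "q \<in> S i u" "j < k" "r \<in> S j v" "3 * i + q = 3 * j + r"
        by (auto simp: c_def)
      then have "q < 3" "r < 3" using S(1) uv by blast+
      then have "i = j" using q(5) by linarith
      moreover from this have "q = r" using q(5) by simp
      ultimately show False using S(3)[of i u v] q uv by auto
    qed
  qed
  then have "fractional_chromatic_number G \<le> real (3 * k) / real (k + 1)"
    using fractional_chromatic_number_le \<open>k \<noteq> 0\<close> by fastforce
  also have "\<dots> = 3 - 3 / (real k + 1)" by (simp add: field_simps)
  finally show ?thesis .
qed

end
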